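(* Let $E$ be a reflexive real Banach space and let $f:E\to\mathbb{R}$ be a strongly coercive Bregman function which is bounded on bounded sets, locally uniformly convex and locally uniformly smooth on $E$. Let $C$ be a nonempty, closed and convex subset of $E$. Let $T:C\to C$ be a Bregman generalized $\alpha$-nonexpansive mapping with $F(T)\neq\emptyset$. Let $\{\alpha_n\}_{n\in\mathbb{N}}$, $\{\beta_n\}_{n\in\mathbb{N}}$ and $\{\gamma_n\}_{n\in\mathbb{N}}$ be three sequences in $[0,1)$ satisfying $\sum_{n=1}^\infty\gamma_n\beta_n\alpha_n(1-\alpha_n)=+\infty$. Let $\{x_n\}_{n\in\mathbb{N}}$ be generated, together with sequences $\{y_n\}_{n\in\mathbb{N}}$ and $\{z_n\}_{n\in\mathbb{N}}$ (all in $C$), by $$z_n=\nabla f^*[\alpha_n\nabla f(Tx_n)+(1-\alpha_n)\nabla f(x_n)],$$ $$y_n=\nabla f^*[\beta_n\nabla f(Tz_n)+(1-\beta_n)\nabla f(x_n)],$$ $$x_{n+1}=\mathrm{proj}_C^f\big(\nabla f^*[\gamma_n\nabla f(Ty_n)+(1-\gamma_n)\nabla f(x_n)]\big)\qquad(n\in\mathbb{N}).$$ Then there exists a subsequence $\{x_{n_i}\}_{i\in\mathbb{N}}$ of $\{x_n\}_{n\in\mathbb{N}}$ which converges weakly to a fixed point of $T$ as $i\to\infty$.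
   Context: $E^*$ is the dual of $E$ and $\langle x,x^*\rangle$ is the value of $x^*\in E^*$ at $x\in E$. A convex $f:E\to\mathbb{R}$ is Gâteaux differentiable if for every $x\in E$ the map $y\mapsto\langle y,\nabla f(x)\rangle=\lim_{t\to0}\frac{f(x+ty)-f(x)}{t}$ defines an element $\nabla f(x)\in E^*$. The Bregman distance is $D_f(x,y)=f(x)-f(y)-\langle x-y,\nabla f(y)\rangle$. A function $f:E\to\mathbb{R}$ is a Bregman function if (1) $f$ is continuous, strictly convex and Gâteaux differentiable, and (2) $\{y\in E:D_f(x,y)\le r\}$ is bounded for all $x\in E$ and $r>0$. $f$ is strongly coercive if $f(x_n)/\|x_n\|\to\infty$ whenever $\|x_n\|\to\infty$. Let $B$ be the closed unit ball, $rB$ the closed ball of radius $r$ centered at $0$, and $S_E$ the unit sphere of $E$. $f$ is bounded on bounded sets if $f(rB)$ is bounded for each $r>0$. $f$ is locally uniformly convex (= uniformly convex on bounded subsets) if $\rho_r(t)>0$ for all $r,t>0$, where $\rho_r(t)=\inf_{x,y\in rB,\ \|x-y\|=t,\ \lambda\in(0,1)}\frac{\lambda f(x)+(1-\lambda)f(y)-f(\lambda x+(1-\lambda)y)}{\lambda(1-\lambda)}$. $f$ is locally uniformly smooth if $\lim_{t\downarrow0}\sigma_r(t)/t=0$ for all $r>0$, where $\sigma_r(t)=\sup_{x\in rB,\ y\in S_E,\ \lambda\in(0,1)}\frac{\lambda f(x+(1-\lambda)ty)+(1-\lambda)f(x-\lambda ty)-f(x)}{\lambda(1-\lambda)}$.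 The Fenchel conjugate is $f^*(x^* )=\sup_{x\in E}\{\langle x,x^*\rangle-f(x)\}$; for a strongly coercive Bregman function on a reflexive space, $f^*$ is finite and Gâteaux differentiable on $E^*$ with $\nabla f^*=(\nabla f)^{-1}$. For a nonempty closed convex $C\subseteq E$ and $x\in E$, the Bregman projection $\mathrm{proj}_C^f(x)$ is the unique $x_0\in C$ with $D_f(x_0,x)=\min_{y\in C}D_f(y,x)$. $F(T)=\{p\in C:Tp=p\}$. $T:C\to E$ is Bregman generalized $\alpha$-nonexpansive if $\alpha\in[0,1)$ and $D_f(Tx,Ty)\le\alpha D_f(Tx,y)+\alpha D_f(x,Ty)+(1-2\alpha)D_f(x,y)$ for all $x,y\in C$. *)

theory Defs
  imports "HOL-Analysis.Analysis"
begin

text \<open>The dual space \<open>E\<^sup>*\<close> of a type \<open>'a\<close> is the type \<open>'a \<Rightarrow>\<^sub>L real\<close> of bounded linear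
  functionals, with \<open>\<langle>x, g\<rangle>\<close> rendered as \<open>blinfun_apply g x\<close>.\<close>

definition reflexive_space :: "'a::real_normed_vector itself \<Rightarrow> bool" where
  "reflexive_space _ \<longleftrightarrow>
     (\<forall>\<Phi> :: ('a \<Rightarrow>\<^sub>L real) \<Rightarrow>\<^sub>L real. \<exists>x::'a. \<forall>g. blinfun_apply \<Phi> g = blinfun_apply g x)"

definition weakly_converges :: "(nat \<Rightarrow> 'a::real_normed_vector) \<Rightarrow> 'a \<Rightarrow> bool" where
  "weakly_converges X p \<longleftrightarrow>
     (\<forall>g :: 'a \<Rightarrow>\<^sub>L real. (\<lambda>i. blinfun_apply g (X i)) \<longlonglongrightarrow> blinfun_apply g p)"

definition has_gateaux_gradient ::
    "('a::real_normed_vector \<Rightarrow> real) \<Rightarrow> ('a \<Rightarrow>\<^sub>L real) \<Rightarrow> 'a \<Rightarrow> bool" where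
  "has_gateaux_gradient f g x \<longleftrightarrow>
     (\<forall>y. ((\<lambda>t::real. (f (x + t *\<^sub>R y) - f x) / t) \<longlongrightarrow> blinfun_apply g y) (at 0))"

definition gateaux_differentiable :: "('a::real_normed_vector \<Rightarrow> real) \<Rightarrow> bool" where
  "gateaux_differentiable f \<longleftrightarrow> (\<forall>x. \<exists>g. has_gateaux_gradient f g x)"

definition grad :: "('a::real_normed_vector \<Rightarrow> real) \<Rightarrow> 'a \<Rightarrow> ('a \<Rightarrow>\<^sub>L real)" where
  "grad f x = (THE g. has_gateaux_gradient f g x)"

definition bregman_dist :: "('a::real_normed_vector \<Rightarrow> real) \<Rightarrow> 'a \<Rightarrow> 'a \<Rightarrow> real" where
  "bregman_dist f x y = f x - f y - blinfun_apply (grad f y) (x - y)"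

definition strictly_convex :: "('a::real_vector \<Rightarrow> real) \<Rightarrow> bool" where
  "strictly_convex f \<longleftrightarrow>
     (\<forall>x y. \<forall>l\<in>{0<..<1}. x \<noteq> y \<longrightarrow>
        f (l *\<^sub>R x + (1 - l) *\<^sub>R y) < l * f x + (1 - l) * f y)"

definition bregman_function :: "('a::real_normed_vector \<Rightarrow> real) \<Rightarrow> bool" where
  "bregman_function f \<longleftrightarrow>
     continuous_on UNIV f \<and> strictly_convex f \<and> gateaux_differentiable f \<and>
     (\<forall>x. \<forall>r>0. bounded {y. bregman_dist f x y \<le> r})"

definition strongly_coercive :: "('a::real_normed_vector \<Rightarrow> real) \<Rightarrow> bool" where
  "strongly_coercive f \<longleftrightarrow>
     (\<forall>X :: nat \<Rightarrow> 'a. filterlim (\<lambda>n. norm (X n)) at_top sequentially \<longrightarrow>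
        filterlim (\<lambda>n. f (X n) / norm (X n)) at_top sequentially)"

definition bounded_on_bounded_sets :: "('a::real_normed_vector \<Rightarrow> real) \<Rightarrow> bool" where
  "bounded_on_bounded_sets f \<longleftrightarrow> (\<forall>r>0. bounded (f ` cball 0 r))"

text \<open>The two moduli are extended reals: the infimum is over the empty set, hence \<open>\<infinity>\<close>, when
  \<open>t > 2 * r\<close>, and the supremum need not be finite.\<close>

definition convexity_modulus ::
    "('a::real_normed_vector \<Rightarrow> real) \<Rightarrow> real \<Rightarrow> real \<Rightarrow> ereal" where
  "convexity_modulus f r t =
     Inf {ereal ((l * f x + (1 - l) * f y - f (l *\<^sub>R x + (1 - l) *\<^sub>R y)) / (l * (1 - l))) | x y l.
            x \<in> cball 0 r \<and> y \<in> cball 0 r \<and> norm (x - y) = t \<and> l \<in> {0<..<1}}"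

definition locally_uniformly_convex :: "('a::real_normed_vector \<Rightarrow> real) \<Rightarrow> bool" where
  "locally_uniformly_convex f \<longleftrightarrow> (\<forall>r>0. \<forall>t>0. convexity_modulus f r t > 0)"

definition smoothness_modulus ::
    "('a::real_normed_vector \<Rightarrow> real) \<Rightarrow> real \<Rightarrow> real \<Rightarrow> ereal" where
  "smoothness_modulus f r t =
     Sup {ereal ((l * f (x + ((1 - l) * t) *\<^sub>R y) + (1 - l) * f (x - (l * t) *\<^sub>R y) - f x)
                 / (l * (1 - l))) | x y l.
            x \<in> cball 0 r \<and> y \<in> sphere 0 1 \<and> l \<in> {0<..<1}}"

definition locally_uniformly_smooth :: "('a::real_normed_vector \<Rightarrow> real) \<Rightarrow> bool" where
  "locally_uniformly_smooth f \<longleftrightarrow>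
     (\<forall>r>0. ((\<lambda>t. smoothness_modulus f r t / ereal t) \<longlongrightarrow> 0) (at_right 0))"

text \<open>The conjugate is real-valued; the supremum below is meaningful only where it is finite,
  which holds on all of \<open>E\<^sup>*\<close> for a strongly coercive Bregman function.\<close>

definition fenchel_conjugate ::
    "('a::real_normed_vector \<Rightarrow> real) \<Rightarrow> ('a \<Rightarrow>\<^sub>L real) \<Rightarrow> real" where
  "fenchel_conjugate f g = (SUP x. blinfun_apply g x - f x)"

text \<open>The gradient of the conjugate lies in the bidual; \<open>grad_conjugate f g\<close> is the point of \<open>E\<close>
  representing it under the canonical embedding (it exists when \<open>E\<close> is reflexive).\<close>

definition grad_conjugate ::
    "('a::real_normed_vector \<Rightarrow> real) \<Rightarrow> ('a \<Rightarrow>\<^sub>L real) \<Rightarrow> 'a" where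
  "grad_conjugate f g =
     (THE x. \<forall>h. blinfun_apply (grad (fenchel_conjugate f) g) h = blinfun_apply h x)"

definition bregman_proj ::
    "('a::real_normed_vector \<Rightarrow> real) \<Rightarrow> 'a set \<Rightarrow> 'a \<Rightarrow> 'a" where
  "bregman_proj f C x =
     (THE x0. x0 \<in> C \<and> (\<forall>y\<in>C. bregman_dist f x0 x \<le> bregman_dist f y x))"

definition fixed_points :: "'a set \<Rightarrow> ('a \<Rightarrow> 'a) \<Rightarrow> 'a set" where
  "fixed_points C T = {p \<in> C. T p = p}"

definition bregman_generalized_nonexpansive ::
    "('a::real_normed_vector \<Rightarrow> real) \<Rightarrow> 'a set \<Rightarrow> real \<Rightarrow> ('a \<Rightarrow> 'a) \<Rightarrow> bool" where
  "bregman_generalized_nonexpansive f C a T \<longleftrightarrow>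
     0 \<le> a \<and> a < 1 \<and>
     (\<forall>x\<in>C. \<forall>y\<in>C. bregman_dist f (T x) (T y) \<le>
        a * bregman_dist f (T x) y + a * bregman_dist f x (T y)
          + (1 - 2 * a) * bregman_dist f x y)"

end

theory Submission
  imports Defs "HOL-Library.Diagonal_Subsequence"
begin

text \<open>
  Write \<open>D\<close> for the Bregman distance of \<open>f\<close> and \<open>G\<close> for its gradient. Averaging gradients is an
  operation adapted to \<open>D\<close>: if \<open>G z = l G u + (1 - l) G v\<close>, then
  \<open>l D p u + (1 - l) D p v = D p z + l D z u + (1 - l) D z v\<close> (\<open>gradient_average\<close>).
  With a fixed point \<open>q\<close> of \<open>T\<close> for \<open>p\<close>, and with \<open>D q (T u) \<le> D q u\<close> and the fact that Bregman
  projections onto \<open>C\<close> do not increase \<open>D q\<close>, no step of the iteration increases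
  \<open>D q (x n)\<close>, and the last two terms of the identity measure how much it drops. Uniform smoothness of \<open>f\<close>
  (that is, uniform convexity of the conjugate) bounds them below on bounded sets by a constant
  times \<open>l (1 - l)\<close> as long as \<open>G u\<close> and \<open>G v\<close> stay apart (\<open>gradient_average_gap\<close>). Hence
  \<open>D q (x n)\<close> drops by a constant times \<open>\<gamma> n \<beta> n \<alpha> n (1 - \<alpha> n)\<close> whenever \<open>G (T (x n))\<close> is far
  from \<open>G (x n)\<close>, and as these numbers have a divergent sum, the two gradients come arbitrarily
  close along a subsequence. Uniform convexity of \<open>f\<close> transfers this to the points, so
  \<open>T (x n) - x n\<close> tends to zero there.

  A further subsequence converges weakly (\<open>bounded_weakly_convergent_subsequence\<close>), its limit \<open>p\<close>
  lies in \<open>C\<close> (\<open>weakly_closed\<close>), and \<open>T p = p\<close> by an argument of Opial type (\<open>demiclosed\<close>): along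
  the sequence \<open>D (x n) (T p) - D (x n) p\<close> tends to \<open>D p (T p)\<close>, while the inequality for \<open>T\<close>
  makes this limit nonpositive.

  The functional analysis rests on one existence result. For a coercive, uniformly convex \<open>f\<close> a
  minimizing sequence of \<open>f - g\<close> on a closed convex set \<open>K\<close> is Cauchy, so the minimum is attained,
  and the minimizer \<open>u\<close> satisfies \<open>\<langle>y - u, G u - g\<rangle> \<ge> 0\<close> on \<open>K\<close> (\<open>variational_inequality_solution\<close>).
  Depending on \<open>K\<close> this yields the bijectivity of \<open>G\<close> with \<open>G\<inverse>\<close> the gradient of the conjugate,
  the Bregman projection, and the representation of functionals on a subspace by gradients at
  points of that subspace. Gradients thereby do the work of the Hahn-Banach theorem: they
  separate points from each other and from closed convex sets.
\<close>

section \<open>Gradients of convex functions\<close>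

lemma has_gateaux_gradient_unique:
  assumes "has_gateaux_gradient f g x" "has_gateaux_gradient f h x"
  shows "g = h"
proof (rule blinfun_eqI)
  fix y
  show "blinfun_apply g y = blinfun_apply h y"
    using assms unfolding has_gateaux_gradient_def
    by (blast intro: tendsto_unique[OF at_neq_bot])
qed

lemma grad_eqI: "has_gateaux_gradient f g x \<Longrightarrow> grad f x = g"
  unfolding grad_def by (blast intro: the_equality has_gateaux_gradient_unique)

locale gateaux_convex =
  fixes f :: "'a::real_normed_vector \<Rightarrow> real"
  assumes convex: "convex_on UNIV f"
    and differentiable: "gateaux_differentiable f"
begin

abbreviation G :: "'a \<Rightarrow> ('a \<Rightarrow>\<^sub>L real)" where "G \<equiv> grad f"

abbreviation D :: "'a \<Rightarrow> 'a \<Rightarrow> real" where "D \<equiv> bregman_dist f"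

lemma grad_limit_right:
  "((\<lambda>t. (f (x + t *\<^sub>R y) - f x) / t) \<longlongrightarrow> blinfun_apply (G x) y) (at_right 0)"
proof -
  obtain g where "has_gateaux_gradient f g x"
    using differentiable unfolding gateaux_differentiable_def by blast
  then have "has_gateaux_gradient f (G x) x"
    using grad_eqI by blast
  then show ?thesis
    unfolding has_gateaux_gradient_def by (blast intro: tendsto_mono at_le)
qed

lemma convex_step:
  assumes "0 \<le> t" "t \<le> 1"
  shows "f (x + t *\<^sub>R (y - x)) \<le> f x + t * (f y - f x)"
  using convex_onD[OF convex assms, of x y] by (simp add: algebra_simps)

lemma gradient_inequality: "f x + blinfun_apply (G x) (y - x) \<le> f y"
proof -
  have "blinfun_apply (G x) (y - x) \<le> f y - f x"
  proof (rule tendsto_upperbound[OF grad_limit_right])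
    show "eventually (\<lambda>t. (f (x + t *\<^sub>R (y - x)) - f x) / t \<le> f y - f x) (at_right 0)"
      unfolding eventually_at_right_field
    proof (intro exI[of _ 1] conjI allI impI)
      fix t :: real assume t: "0 < t" "t < 1"
      then have "f (x + t *\<^sub>R (y - x)) - f x \<le> t * (f y - f x)"
        using convex_step[of t x y] by simp
      then show "(f (x + t *\<^sub>R (y - x)) - f x) / t \<le> f y - f x"
        using t by (simp add: pos_divide_le_eq mult.commute)
    qed simp
  qed simp
  then show ?thesis by simp
qed

lemma bregman_dist_nonneg: "0 \<le> D y x"
  using gradient_inequality[of x y] by (simp add: bregman_dist_def)

lemma bregman_dist_self [simp]: "D x x = 0"
  by (simp add: bregman_dist_def blinfun.zero_right)

lemma bregman_dist_sym_sum: "D x y + D y x = blinfun_apply (G x - G y) (x - y)"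
  by (simp add: bregman_dist_def blinfun.diff_left blinfun.diff_right)

lemma three_point:
  "D y x = D y u + D u x + blinfun_apply (G u - G x) (y - u)"
  by (simp add: bregman_dist_def blinfun.diff_left blinfun.diff_right)

text \<open>The identity is exact, with the distances from \<open>z\<close> as the gain. This is why the iteration
  averages gradients rather than points.\<close>

lemma gradient_average:
  assumes "G z = l *\<^sub>R G u + (1 - l) *\<^sub>R G v"
  shows "l * D p u + (1 - l) * D p v = D p z + (l * D z u + (1 - l) * D z v)"
proof -
  have "l * (D p u - D p z - D z u) + (1 - l) * (D p v - D p z - D z v)
        = blinfun_apply (l *\<^sub>R (G z - G u) + (1 - l) *\<^sub>R (G z - G v)) (p - z)"
    using three_point[of p u z] three_point[of p v z]
    by (simp add: blinfun.add_left blinfun.scaleR_left)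
  also have "l *\<^sub>R (G z - G u) + (1 - l) *\<^sub>R (G z - G v) = 0"
  proof -
    have "l *\<^sub>R (G z - G u) + (1 - l) *\<^sub>R (G z - G v)
          = (l *\<^sub>R G z + (1 - l) *\<^sub>R G z) - (l *\<^sub>R G u + (1 - l) *\<^sub>R G v)"
      by (simp add: scaleR_right_diff_distrib)
    also have "l *\<^sub>R G z + (1 - l) *\<^sub>R G z = G z"
      by (simp flip: scaleR_add_left)
    finally show ?thesis using assms by simp
  qed
  finally show ?thesis
    by (simp add: algebra_simps)
qed

lemma gradient_average_le:
  assumes "G z = l *\<^sub>R G u + (1 - l) *\<^sub>R G v" "0 \<le> l" "l \<le> 1"
  shows "D p z \<le> l * D p u + (1 - l) * D p v"
  using gradient_average[OF assms(1), of p] assms(2,3)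
    bregman_dist_nonneg[of z u] bregman_dist_nonneg[of z v] by simp

lemma minimizer_variational_inequality:
  assumes K: "convex K" "u \<in> K" "y \<in> K"
    and min: "\<And>v. v \<in> K \<Longrightarrow> f u - blinfun_apply g u \<le> f v - blinfun_apply g v"
  shows "0 \<le> blinfun_apply (G u - g) (y - u)"
proof -
  have "blinfun_apply g (y - u) \<le> blinfun_apply (G u) (y - u)"
  proof (rule tendsto_lowerbound[OF grad_limit_right])
    show "eventually (\<lambda>t. blinfun_apply g (y - u) \<le> (f (u + t *\<^sub>R (y - u)) - f u) / t) (at_right 0)"
      unfolding eventually_at_right_field
    proof (intro exI[of _ 1] conjI allI impI)
      fix t :: real assume t: "0 < t" "t < 1"
      have "(1 - t) *\<^sub>R u + t *\<^sub>R y \<in> K"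
        using K t by (intro convexD) auto
      then have "u + t *\<^sub>R (y - u) \<in> K"
        by (simp add: algebra_simps)
      from min[OF this] have "t * blinfun_apply g (y - u) \<le> f (u + t *\<^sub>R (y - u)) - f u"
        by (simp add: blinfun.add_right blinfun.scaleR_right)
      then show "blinfun_apply g (y - u) \<le> (f (u + t *\<^sub>R (y - u)) - f u) / t"
        using t by (simp add: pos_le_divide_eq mult.commute)
    qed simp
  qed simp
  then show ?thesis by (simp add: blinfun.diff_left)
qed

end

section \<open>Uniform convexity and coercivity\<close>

lemma half_sum_diff: "(1/2) *\<^sub>R w + (1/2) *\<^sub>R y - y = (1/2) *\<^sub>R (w - (y::'a::real_vector))"
proof -
  have "y = (1/2) *\<^sub>R y + (1/2) *\<^sub>R y"
    by (metis scaleR_add_right scaleR_half_double)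
  then have "(1/2) *\<^sub>R w + (1/2) *\<^sub>R y - y = (1/2) *\<^sub>R w + (1/2) *\<^sub>R y - ((1/2) *\<^sub>R y + (1/2) *\<^sub>R y)"
    by simp
  then show ?thesis by (simp add: scaleR_diff_right)
qed

lemma abs_divide_bound:
  assumes "t \<noteq> (0::real)" "\<bar>Q - t * a\<bar> \<le> \<bar>t\<bar> * b"
  shows "\<bar>Q / t - a\<bar> \<le> b"
proof -
  have "Q / t - a = (Q - t * a) / t" using assms(1) by (simp add: field_simps)
  then show ?thesis using assms by (simp add: abs_divide pos_divide_le_eq mult.commute)
qed

locale coercive_uniformly_convex = gateaux_convex f
  for f :: "'a::banach \<Rightarrow> real" +
  assumes continuous: "continuous_on UNIV f"
    and coercive: "strongly_coercive f"
    and uniformly_convex: "locally_uniformly_convex f"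
begin

text \<open>Comparing \<open>f\<close> at a midpoint with its tangent at \<open>y\<close> turns the modulus, which concerns chords,
  into a bound on the distance above tangents.\<close>

lemma bregman_dist_lower_bound:
  assumes "0 < t"
  obtains c where "0 < c"
    "\<And>x y. \<lbrakk>norm x \<le> r; norm y \<le> r; t \<le> norm (x - y)\<rbrakk> \<Longrightarrow> c \<le> D x y"
proof -
  define R where "R = max r 1"
  have "0 < R" by (simp add: R_def)
  then have "0 < convexity_modulus f R t"
    using uniformly_convex assms unfolding locally_uniformly_convex_def by blast
  then obtain c where c: "0 < ereal c" "ereal c < convexity_modulus f R t"
    using ereal_dense2 by blast
  have "c / 2 \<le> D x y" if "norm x \<le> r" "norm y \<le> r" "t \<le> norm (x - y)" for x y
  proof -
    \<comment> \<open>The modulus speaks of distance exactly \<open>t\<close>, so \<open>x\<close> is first pulled towards \<open>y\<close>.\<close>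
    define s where "s = t / norm (x - y)"
    define w where "w = y + s *\<^sub>R (x - y)"
    have "0 < norm (x - y)" using assms that(3) by linarith
    then have s: "0 < s" "s \<le> 1" using assms that(3) by (simp_all add: s_def)
    have "norm (w - y) = t"
      using assms \<open>0 < norm (x - y)\<close> by (simp add: w_def s_def)
    have "(1 - s) *\<^sub>R y + s *\<^sub>R x \<in> cball 0 R"
      using s that R_def by (intro convexD[OF convex_cball]) auto
    then have "w \<in> cball 0 R" by (simp add: w_def algebra_simps)
    have "y \<in> cball 0 R" using that by (simp add: R_def)
    have "convexity_modulus f R t \<le>
      ereal (((1/2) * f w + (1 - 1/2) * f y - f ((1/2) *\<^sub>R w + (1 - 1/2) *\<^sub>R y)) / ((1/2) * (1 - 1/2)))"
      unfolding convexity_modulus_def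
      using \<open>w \<in> cball 0 R\<close> \<open>y \<in> cball 0 R\<close> \<open>norm (w - y) = t\<close>
      by (intro Inf_lower CollectI exI[of _ w] exI[of _ y] exI[of _ "1/2"]) auto
    from less_le_trans[OF c(2) this]
    have "c < 4 * ((1/2) * f w + (1/2) * f y - f ((1/2) *\<^sub>R w + (1/2) *\<^sub>R y))"
      by simp
    moreover have "f y + blinfun_apply (G y) ((1/2) *\<^sub>R w + (1/2) *\<^sub>R y - y) \<le> f ((1/2) *\<^sub>R w + (1/2) *\<^sub>R y)"
      by (rule gradient_inequality)
    moreover have "(1/2) *\<^sub>R w + (1/2) *\<^sub>R y - y = (1/2) *\<^sub>R (w - y)"
      by (rule half_sum_diff)
    ultimately have "c / 2 \<le> f w - f y - blinfun_apply (G y) (w - y)"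
      by (simp add: blinfun.scaleR_right)
    also have "\<dots> \<le> s * D x y"
    proof -
      have "w - y = s *\<^sub>R (x - y)" by (simp add: w_def)
      moreover have "f w \<le> f y + s * (f x - f y)"
        unfolding w_def using s by (intro convex_step) auto
      ultimately show ?thesis
        by (simp add: bregman_dist_def blinfun.scaleR_right right_diff_distrib)
    qed
    also have "\<dots> \<le> D x y"
      using s bregman_dist_nonneg[of x y] by (simp add: mult_left_le_one_le)
    finally show ?thesis .
  qed
  with c(1) show ?thesis by (intro that[of "c/2"]) auto
qed

lemma bregman_dist_pos:
  assumes "x \<noteq> y" shows "0 < D x y"
proof -
  have "0 < norm (x - y)" using assms by simp
  from bregman_dist_lower_bound[OF this, of "max (norm x) (norm y)"]
  obtain c where "0 < c" "c \<le> D x y" by (metis max.cobounded1 max.cobounded2 order_refl)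
  then show ?thesis by simp
qed

lemma bregman_dist_le_0_iff: "D x y \<le> 0 \<longleftrightarrow> x = y"
  using bregman_dist_pos[of x y] by force

lemma gradient_strictly_monotone:
  "x \<noteq> y \<Longrightarrow> 0 < blinfun_apply (G x - G y) (x - y)"
  using bregman_dist_sym_sum[of x y] bregman_dist_pos[of x y] bregman_dist_nonneg[of y x] by simp

text \<open>Coercivity in the form in which it yields bounds: \<open>R\<close> depends only on the affine
  majorant in the norm, so it serves all functionals of norm at most \<open>b\<close> at once.\<close>

lemma superlinear_growth:
  obtains R where "0 < R" "\<And>x. f x \<le> c + b * norm x \<Longrightarrow> norm x \<le> R"
proof -
  have "\<exists>R>0. \<forall>x. f x \<le> c + b * norm x \<longrightarrow> norm x \<le> R"
  proof (rule ccontr)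
    assume "\<not> ?thesis"
    then have "\<exists>x. f x \<le> c + b * norm x \<and> real (Suc n) < norm x" for n
      by (meson not_le of_nat_0_less_iff zero_less_Suc)
    then obtain X where X: "\<And>n. f (X n) \<le> c + b * norm (X n)" "\<And>n. real (Suc n) < norm (X n)"
      by metis
    have "filterlim (\<lambda>n. norm (X n)) at_top sequentially"
    proof (rule filterlim_at_top_mono[OF filterlim_real_sequentially always_eventually], rule allI)
      show "real n \<le> norm (X n)" for n using X(2)[of n] by simp
    qed
    then have "filterlim (\<lambda>n. f (X n) / norm (X n)) at_top sequentially"
      using coercive unfolding strongly_coercive_def by blast
    then have "eventually (\<lambda>n. \<bar>c\<bar> + b < f (X n) / norm (X n)) sequentially"
      unfolding filterlim_at_top_dense by blast
    then obtain n where n: "\<bar>c\<bar> + b < f (X n) / norm (X n)"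
      using eventually_happens'[OF sequentially_bot] by blast
    have "1 \<le> norm (X n)" using X(2)[of n] by simp
    have "f (X n) / norm (X n) \<le> (c + b * norm (X n)) / norm (X n)"
      using X(1) by (simp add: divide_right_mono)
    also have "\<dots> = c / norm (X n) + b"
      using \<open>1 \<le> norm (X n)\<close> by (auto simp: add_divide_distrib)
    also have "c / norm (X n) \<le> \<bar>c\<bar> / 1"
      using \<open>1 \<le> norm (X n)\<close> by (intro frac_le) auto
    finally show False using n by simp
  qed
  then show ?thesis using that by blast
qed

text \<open>Growth confines minimizing sequences of \<open>f - g\<close> to a ball, and there uniform convexity makes
  them Cauchy, so completeness provides the minimizer.\<close>

lemma minimizer_exists:
  assumes K: "closed K" "convex K" "K \<noteq> {}"
  obtains u where "u \<in> K"
    "\<And>v. v \<in> K \<Longrightarrow> f u - blinfun_apply g u \<le> f v - blinfun_apply g v"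
proof -
  define h where "h v = f v - blinfun_apply g v" for v
  define m where "m = Inf (h ` K)"
  have g_le: "blinfun_apply g v \<le> norm g * norm v" for v
    using norm_blinfun[of g v] by simp
  obtain v0 where v0: "v0 \<in> K" using K(3) by blast
  obtain R where R: "0 < R" "\<And>x. f x \<le> (\<bar>h v0\<bar> + 1) + norm g * norm x \<Longrightarrow> norm x \<le> R"
    using superlinear_growth[of "\<bar>h v0\<bar> + 1" "norm g"] by metis
  have low_R: "norm v \<le> R" if "h v \<le> \<bar>h v0\<bar> + 1" for v
    using that g_le[of v] by (intro R(2)) (simp add: h_def)
  \<comment> \<open>Where \<open>h\<close> is at most \<open>\<bar>h v0\<bar> + 1\<close> the tangent at \<open>0\<close> bounds it below, elsewhere it is positive.\<close>
  have "min 0 (f 0 - (norm (G 0) + norm g) * R) \<le> h v" for v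
  proof (cases "h v \<le> \<bar>h v0\<bar> + 1")
    case True
    then have "norm v \<le> R" by (rule low_R)
    have "- blinfun_apply (G 0) v \<le> norm (G 0) * norm v"
      using norm_blinfun[of "G 0" v] by simp
    then have "f 0 - (norm (G 0) + norm g) * norm v \<le> h v"
      using gradient_inequality[of 0 v] g_le[of v] by (simp add: h_def algebra_simps)
    moreover have "(norm (G 0) + norm g) * norm v \<le> (norm (G 0) + norm g) * R"
      using \<open>norm v \<le> R\<close> by (intro mult_left_mono) auto
    ultimately show ?thesis by simp
  qed simp
  then have bdd: "bdd_below (h ` K)" by (auto intro!: bdd_belowI)
  have m_le: "m \<le> h v" if "v \<in> K" for v
    unfolding m_def using bdd that by (simp add: cInf_lower)
  have "\<exists>v\<in>K. h v < m + 1 / Suc n" for n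
  proof -
    have "Inf (h ` K) < m + 1 / Suc n" by (simp add: m_def)
    then show ?thesis using cInf_lessD[of "h ` K"] K(3) by blast
  qed
  then obtain X where X: "\<And>n. X n \<in> K" "\<And>n. h (X n) < m + 1 / Suc n" by metis
  have X_R: "norm (X n) \<le> R" for n
  proof (rule low_R)
    have "1 / real (Suc n) \<le> 1" by simp
    then show "h (X n) \<le> \<bar>h v0\<bar> + 1" using X(2)[of n] m_le[OF v0] by linarith
  qed
  \<comment> \<open>Two almost minimal points are close, because \<open>f\<close> drops at their midpoint.\<close>
  have "Cauchy X"
  proof (rule metric_CauchyI)
    fix e :: real assume "0 < e"
    then have "0 < e / 2" by simp
    from bregman_dist_lower_bound[OF this, of R] obtain c where c: "0 < c"
      "\<And>x y. \<lbrakk>norm x \<le> R; norm y \<le> R; e / 2 \<le> norm (x - y)\<rbrakk> \<Longrightarrow> c \<le> D x y" by metis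
    obtain N where N: "1 / real (Suc N) < c / 2"
      using nat_approx_posE[of "c/2"] c(1) by auto
    have "dist (X i) (X j) < e" if ij: "N \<le> i" "N \<le> j" for i j
    proof (rule ccontr)
      assume "\<not> ?thesis"
      then have far: "e \<le> norm (X i - X j)" by (simp add: dist_norm)
      define w where "w = (1/2) *\<^sub>R X i + (1/2) *\<^sub>R X j"
      have "w \<in> K" unfolding w_def using X(1) K(2) by (intro convexD) auto
      have "w \<in> cball 0 R" unfolding w_def using X_R by (intro convexD[OF convex_cball]) auto
      have wi: "X i - w = (1/2) *\<^sub>R (X i - X j)" "X j - w = - ((1/2) *\<^sub>R (X i - X j))"
        using half_sum_diff[of "X i" "X j"] half_sum_diff[of "X j" "X i"]
        by (simp_all add: w_def algebra_simps)
      have "c \<le> D (X i) w"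
        using far \<open>w \<in> cball 0 R\<close> X_R by (intro c(2)) (auto simp: wi)
      moreover have "D (X i) w + D (X j) w = f (X i) + f (X j) - 2 * f w"
        by (simp add: bregman_dist_def wi blinfun.scaleR_right blinfun.minus_right)
      moreover have "f (X i) + f (X j) - 2 * f w = h (X i) + h (X j) - 2 * h w"
        by (simp add: h_def w_def blinfun.add_right blinfun.scaleR_right)
      moreover have "m \<le> h w" by (rule m_le[OF \<open>w \<in> K\<close>])
      moreover have "1 / real (Suc i) \<le> 1 / real (Suc N)" "1 / real (Suc j) \<le> 1 / real (Suc N)"
        using ij by (auto intro!: divide_left_mono)
      ultimately show False
        using X(2)[of i] X(2)[of j] N bregman_dist_nonneg[of "X j" w] by linarith
    qed
    then show "\<exists>M. \<forall>i\<ge>M. \<forall>j\<ge>M. dist (X i) (X j) < e" by blast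
  qed
  then obtain u where u: "X \<longlonglongrightarrow> u" using Cauchy_convergent convergent_def by blast
  have "u \<in> K" using closed_sequentially[OF K(1) X(1) u] .
  have "(\<lambda>n. h (X n)) \<longlonglongrightarrow> h u"
    unfolding h_def using u continuous
    by (intro tendsto_diff blinfun.tendsto tendsto_const)
      (auto simp: continuous_on_eq_continuous_at isCont_def intro: continuous_within_tendsto_compose isCont_tendsto_compose)
  moreover have "(\<lambda>n. m + 1 / Suc n) \<longlonglongrightarrow> m + 0"
    by (intro tendsto_add tendsto_const LIMSEQ_Suc[OF lim_1_over_n])
  ultimately have "h u \<le> m + 0"
    using X(2) less_imp_le by (intro LIMSEQ_le) blast+
  then show ?thesis
    using that[OF \<open>u \<in> K\<close>] m_le unfolding h_def by fastforce
qed

text \<open>Three choices of \<open>K\<close> and \<open>g\<close> matter: a closed subspace, in particular the whole space, where the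
  inequality becomes the equation \<open>G u = g\<close> on it, and a closed convex set with \<open>g = G x\<close>, where it
  characterizes the Bregman projection of \<open>x\<close>.\<close>

lemma variational_inequality_solution:
  assumes "closed K" "convex K" "K \<noteq> {}"
  obtains u where "u \<in> K" "\<And>y. y \<in> K \<Longrightarrow> 0 \<le> blinfun_apply (G u - g) (y - u)"
  using minimizer_exists[OF assms, of g] minimizer_variational_inequality[OF assms(2)] by metis

lemma gradient_on_subspace:
  assumes "closed M" "subspace M"
  obtains u where "u \<in> M" "\<And>y. y \<in> M \<Longrightarrow> blinfun_apply (G u) y = blinfun_apply g y"
proof -
  obtain u where u: "u \<in> M" "\<And>y. y \<in> M \<Longrightarrow> 0 \<le> blinfun_apply (G u - g) (y - u)"
    using variational_inequality_solution[OF assms(1) subspace_imp_convex[OF assms(2)]]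
      subspace_0[OF assms(2)] by blast
  have "blinfun_apply (G u) y = blinfun_apply g y" if "y \<in> M" for y
    using u(2)[of "u + y"] u(2)[of "u - y"] u(1) that assms(2)
    by (simp add: subspace_add subspace_diff blinfun.diff_left blinfun.minus_right)
  with u(1) show ?thesis using that by blast
qed

lemma gradient_surjective:
  obtains u where "G u = g"
proof -
  obtain u where "\<And>y. blinfun_apply (G u) y = blinfun_apply g y"
    using gradient_on_subspace[of UNIV g] by auto
  then show ?thesis using that blinfun_eqI by blast
qed

text \<open>The symmetrized distance equals \<open>\<langle>u - v, G u - G v\<rangle>\<close>, which is at most the diameter of the ball
  times the distance of the gradients.\<close>

lemma gradient_inverse_continuous_on_ball:
  assumes "0 < e"
  obtains d where "0 < d"
    "\<And>u v. \<lbrakk>norm u \<le> r; norm v \<le> r; norm (G u - G v) < d\<rbrakk> \<Longrightarrow> norm (u - v) < e"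
proof -
  obtain c where c: "0 < c"
    "\<And>x y. \<lbrakk>norm x \<le> r; norm y \<le> r; e \<le> norm (x - y)\<rbrakk> \<Longrightarrow> c \<le> D x y"
    using bregman_dist_lower_bound[OF assms, of r] by metis
  define d where "d = c / (2 * \<bar>r\<bar> + 1)"
  have "0 < d" using c(1) by (simp add: d_def)
  have "norm (u - v) < e" if "norm u \<le> r" "norm v \<le> r" "norm (G u - G v) < d" for u v
  proof (rule ccontr)
    assume "\<not> ?thesis"
    then have "c \<le> D u v" using that by (intro c(2)) auto
    also have "\<dots> \<le> blinfun_apply (G u - G v) (u - v)"
      using bregman_dist_sym_sum[of u v] bregman_dist_nonneg[of v u] by simp
    also have "\<dots> \<le> norm (G u - G v) * norm (u - v)"
      using norm_blinfun[of "G u - G v" "u - v"] by simp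
    also have "\<dots> \<le> d * (2 * \<bar>r\<bar>)"
      using that norm_triangle_ineq4[of u v] \<open>0 < d\<close> by (intro mult_mono) auto
    also have "\<dots> < d * (2 * \<bar>r\<bar> + 1)" using \<open>0 < d\<close> by simp
    also have "\<dots> = c" by (simp add: d_def)
    finally show False by simp
  qed
  with \<open>0 < d\<close> show ?thesis using that by blast
qed

text \<open>The tangent at \<open>v\<close> gives \<open>f v \<le> f 0 + \<parallel>G v\<parallel> \<parallel>v\<parallel>\<close>, so points with gradients near \<open>G u\<close> lie in
  a common ball and the estimate on balls applies.\<close>

lemma gradient_inverse_continuous:
  assumes "0 < e"
  obtains d where "0 < d" "\<And>v. norm (G v - G u) < d \<Longrightarrow> norm (v - u) < e"
proof -
  obtain R where R: "0 < R" "\<And>x. f x \<le> f 0 + (norm (G u) + 1) * norm x \<Longrightarrow> norm x \<le> R"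
    using superlinear_growth[of "f 0" "norm (G u) + 1"] by metis
  have bound: "norm v \<le> R" if "norm (G v - G u) < 1" for v
  proof (rule R(2))
    have "f v \<le> f 0 + blinfun_apply (G v) v"
      using gradient_inequality[of v 0] by (simp add: blinfun.minus_right)
    also have "blinfun_apply (G v) v \<le> norm (G v) * norm v"
      using norm_blinfun[of "G v" v] by simp
    also have "\<dots> \<le> (norm (G u) + 1) * norm v"
      using that norm_triangle_ineq2[of "G v" "G u"] by (intro mult_right_mono) auto
    finally show "f v \<le> f 0 + (norm (G u) + 1) * norm v" by simp
  qed
  obtain d where d: "0 < d"
    "\<And>a b. \<lbrakk>norm a \<le> R; norm b \<le> R; norm (G a - G b) < d\<rbrakk> \<Longrightarrow> norm (a - b) < e"
    using gradient_inverse_continuous_on_ball[OF assms, of R] by metis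
  show ?thesis
  proof
    show "0 < min 1 d" using d(1) by simp
    fix v assume "norm (G v - G u) < min 1 d"
    then show "norm (v - u) < e" using bound[of v] bound[of u] by (intro d(2)) auto
  qed
qed

subsection \<open>The gradient of the conjugate\<close>

lemma fenchel_conjugate_gradient:
  "fenchel_conjugate f (G u) = blinfun_apply (G u) u - f u"
  unfolding fenchel_conjugate_def
proof (rule cSup_eq_maximum)
  fix s assume "s \<in> range (\<lambda>x. blinfun_apply (G u) x - f x)"
  then obtain x where "s = blinfun_apply (G u) x - f x" by blast
  then show "s \<le> blinfun_apply (G u) u - f u"
    using gradient_inequality[of u x] by (simp add: blinfun.diff_right)
qed blast

text \<open>If \<open>G v = G u + t h\<close>, the increment of the conjugate from \<open>G u\<close> to \<open>G v\<close> exceeds \<open>t \<langle>u, h\<rangle>\<close> by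
  \<open>D u v\<close>, which lies between \<open>0\<close> and \<open>t \<langle>v - u, h\<rangle>\<close>. Dividing by \<open>t\<close>, the claim reduces to \<open>v \<rightarrow> u\<close>,
  the continuity of the inverse gradient.\<close>

lemma conjugate_gateaux_gradient:
  "has_gateaux_gradient (fenchel_conjugate f) (Blinfun (\<lambda>h. blinfun_apply h u)) (G u)"
  unfolding has_gateaux_gradient_def
proof
  fix h :: "'a \<Rightarrow>\<^sub>L real"
  let ?q = "\<lambda>t. (fenchel_conjugate f (G u + t *\<^sub>R h) - fenchel_conjugate f (G u)) / t"
  have ev: "blinfun_apply (Blinfun (\<lambda>h. blinfun_apply h u)) h = blinfun_apply h u"
    by (simp add: bounded_linear_Blinfun_apply blinfun.bounded_linear_left)
  have "(?q \<longlongrightarrow> blinfun_apply h u) (at 0)"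
    unfolding tendsto_iff
  proof (intro allI impI)
    fix e :: real assume "0 < e"
    then have e': "0 < e / (norm h + 1)" by (simp add: add_nonneg_pos)
    from gradient_inverse_continuous[OF e', of u] obtain d where d: "0 < d"
      "\<And>v. norm (G v - G u) < d \<Longrightarrow> norm (v - u) < e / (norm h + 1)" by metis
    have "dist (?q t) (blinfun_apply h u) < e" if t: "t \<noteq> 0" "dist t 0 < d / (norm h + 1)" for t
    proof -
      obtain v where v: "G v = G u + t *\<^sub>R h" using gradient_surjective .
      have "\<bar>t\<bar> * norm h \<le> \<bar>t\<bar> * (norm h + 1)" by (intro mult_left_mono) auto
      also have "\<dots> < d" using t by (simp add: pos_less_divide_eq add_nonneg_pos)
      finally have "norm (v - u) < e / (norm h + 1)" by (intro d(2)) (simp add: v)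
      define Q where "Q = fenchel_conjugate f (G u + t *\<^sub>R h) - fenchel_conjugate f (G u)"
      have Q: "Q = blinfun_apply (G v) v - f v - blinfun_apply (G u) u + f u"
        using fenchel_conjugate_gradient[of v] fenchel_conjugate_gradient[of u] by (simp add: Q_def v)
      have "Q - t * blinfun_apply h u = D u v"
        unfolding Q bregman_dist_def v
        by (simp add: blinfun.add_left blinfun.scaleR_left blinfun.diff_right algebra_simps)
      moreover have "D u v \<le> t * blinfun_apply h (v - u)"
        using bregman_dist_sym_sum[of v u] bregman_dist_nonneg[of v u]
        by (simp add: v blinfun.scaleR_left)
      moreover have "t * blinfun_apply h (v - u) \<le> \<bar>t\<bar> * (norm h * norm (v - u))"
      proof -
        have "t * blinfun_apply h (v - u) \<le> \<bar>t\<bar> * \<bar>blinfun_apply h (v - u)\<bar>"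
          by (simp flip: abs_mult)
        also have "\<dots> \<le> \<bar>t\<bar> * (norm h * norm (v - u))"
          using norm_blinfun[of h "v - u"] by (intro mult_left_mono) auto
        finally show ?thesis .
      qed
      ultimately have "\<bar>Q - t * blinfun_apply h u\<bar> \<le> \<bar>t\<bar> * (norm h * norm (v - u))"
        using bregman_dist_nonneg[of u v] by simp
      then have "\<bar>Q / t - blinfun_apply h u\<bar> \<le> norm h * norm (v - u)"
        using t by (intro abs_divide_bound) auto
      also have "\<dots> \<le> (norm h + 1) * norm (v - u)" by (intro mult_right_mono) auto
      also have "\<dots> < e"
        using \<open>norm (v - u) < e / (norm h + 1)\<close>
        by (simp add: pos_less_divide_eq add_nonneg_pos mult.commute)
      finally show ?thesis by (simp add: Q_def dist_real_def)
    qed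
    then show "eventually (\<lambda>t. dist (?q t) (blinfun_apply h u) < e) (at 0)"
      unfolding eventually_at using d(1)
      by (intro exI[of _ "d / (norm h + 1)"]) (auto simp: add_nonneg_pos)
  qed
  then show "(?q \<longlongrightarrow> blinfun_apply (Blinfun (\<lambda>h. blinfun_apply h u)) h) (at 0)"
    by (simp add: ev)
qed

lemma grad_conjugate_gradient: "grad_conjugate f (G u) = u"
  unfolding grad_conjugate_def grad_eqI[OF conjugate_gateaux_gradient]
    bounded_linear_Blinfun_apply[OF blinfun.bounded_linear_left]
proof (rule the_equality)
  fix x assume x: "\<forall>h :: 'a \<Rightarrow>\<^sub>L real. blinfun_apply h u = blinfun_apply h x"
  \<comment> \<open>Gradients already separate points, by strict monotonicity.\<close>
  show "x = u"
  proof (rule ccontr)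
    assume "x \<noteq> u"
    then have "0 < blinfun_apply (G x - G u) (x - u)" by (rule gradient_strictly_monotone)
    moreover have "blinfun_apply (G x - G u) u = blinfun_apply (G x - G u) x"
      using x by blast
    ultimately show False by (simp add: blinfun.diff_right)
  qed
qed simp

lemma gradient_grad_conjugate: "G (grad_conjugate f g) = g"
proof -
  obtain u where "G u = g" using gradient_surjective .
  then show ?thesis using grad_conjugate_gradient[of u] by simp
qed

subsection \<open>Bregman projections\<close>

lemma bregman_proj_properties:
  assumes "closed C" "convex C" "C \<noteq> {}"
  shows "bregman_proj f C x \<in> C"
    and "y \<in> C \<Longrightarrow> D y (bregman_proj f C x) + D (bregman_proj f C x) x \<le> D y x"
proof -
  obtain u where u: "u \<in> C" "\<And>y. y \<in> C \<Longrightarrow> 0 \<le> blinfun_apply (G u - G x) (y - u)"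
    using variational_inequality_solution[OF assms, of "G x"] by metis
  have le: "D y u + D u x \<le> D y x" if "y \<in> C" for y
    using u(2)[OF that] three_point[of y x u] by simp
  have "bregman_proj f C x = u"
    unfolding bregman_proj_def
  proof (rule the_equality)
    show "u \<in> C \<and> (\<forall>y\<in>C. D u x \<le> D y x)"
    proof (intro conjI ballI)
      show "D u x \<le> D y x" if "y \<in> C" for y
        using le[OF that] bregman_dist_nonneg[of y u] by linarith
    qed (rule u(1))
    fix v assume v: "v \<in> C \<and> (\<forall>y\<in>C. D v x \<le> D y x)"
    then have "D v u \<le> 0" using le[of v] u(1) by fastforce
    then show "v = u" by (simp add: bregman_dist_le_0_iff)
  qed
  with u le show "bregman_proj f C x \<in> C"
    "y \<in> C \<Longrightarrow> D y (bregman_proj f C x) + D (bregman_proj f C x) x \<le> D y x" by auto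
qed

text \<open>If \<open>q\<close> is the projection of \<open>p\<close> onto \<open>C\<close>, the functional \<open>G q - G p\<close> separates \<open>p\<close> from \<open>C\<close> strictly
  unless \<open>p = q\<close>.\<close>

lemma weakly_closed:
  fixes X :: "nat \<Rightarrow> 'a"
  assumes C: "closed C" "convex C" and X: "\<And>n. X n \<in> C" and lim: "weakly_converges X p"
  shows "p \<in> C"
proof -
  have "C \<noteq> {}" using X by blast
  then obtain q where q: "q \<in> C" "\<And>y. y \<in> C \<Longrightarrow> 0 \<le> blinfun_apply (G q - G p) (y - q)"
    using variational_inequality_solution[OF C, of "G p"] by metis
  have "(\<lambda>n. blinfun_apply (G q - G p) (X n)) \<longlonglongrightarrow> blinfun_apply (G q - G p) p"
    using lim unfolding weakly_converges_def by blast
  then have "blinfun_apply (G q - G p) q \<le> blinfun_apply (G q - G p) p"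
    by (rule LIMSEQ_le_const) (use q(2)[OF X] in \<open>auto simp: blinfun.diff_right\<close>)
  then have "q = p"
    using gradient_strictly_monotone[of q p] by (auto simp: blinfun.diff_right)
  with q(1) show ?thesis by simp
qed

end

section \<open>Uniform smoothness\<close>

lemma norm_blinfun_le_unit:
  fixes g :: "'a::real_normed_vector \<Rightarrow>\<^sub>L real"
  assumes "0 \<le> b" "\<And>y. norm y = 1 \<Longrightarrow> blinfun_apply g y \<le> b"
  shows "norm g \<le> b"
proof (rule norm_blinfun_bound[OF assms(1)])
  fix y
  show "norm (blinfun_apply g y) \<le> b * norm y"
  proof (cases "y = 0")
    case False
    then have n: "norm (y /\<^sub>R norm y) = 1" "norm (- (y /\<^sub>R norm y)) = 1" by auto
    have "blinfun_apply g (y /\<^sub>R norm y) \<le> b" "blinfun_apply g (- (y /\<^sub>R norm y)) \<le> b"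
      using n by (auto intro: assms(2))
    then have "\<bar>blinfun_apply g y / norm y\<bar> \<le> b"
      by (simp add: blinfun.scaleR_right blinfun.minus_right divide_inverse_commute abs_le_iff)
    then show ?thesis using False by (simp add: abs_divide pos_divide_le_eq)
  qed (simp add: blinfun.zero_right)
qed

locale uniformly_smooth_convex = gateaux_convex f
  for f :: "'a::real_normed_vector \<Rightarrow> real" +
  assumes bounded_on_bounded: "bounded_on_bounded_sets f"
    and uniformly_smooth: "locally_uniformly_smooth f"
begin

text \<open>The modulus at equal weights bounds \<open>f (x + s y) + f (x - s y) - 2 f x\<close>; replacing \<open>f (x - s y)\<close>
  by its lower bound, the tangent at \<open>x\<close>, leaves \<open>D (x + s y) x\<close>.\<close>

lemma bregman_dist_upper_bound:
  assumes "0 < e"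
  obtains s where "0 < s" "\<And>x y. \<lbrakk>norm x \<le> r; norm y = 1\<rbrakk> \<Longrightarrow> D (x + s *\<^sub>R y) x \<le> e * s"
proof -
  define R where "R = max r 1"
  have "0 < R" by (simp add: R_def)
  then have "((\<lambda>t. smoothness_modulus f R t / ereal t) \<longlongrightarrow> 0) (at_right 0)"
    using uniformly_smooth unfolding locally_uniformly_smooth_def by blast
  then have "eventually (\<lambda>t. smoothness_modulus f R t / ereal t < ereal e) (at_right 0)"
    using assms by (intro order_tendstoD) auto
  then obtain b where b: "0 < b" "\<And>t. \<lbrakk>0 < t; t < b\<rbrakk> \<Longrightarrow> smoothness_modulus f R t / ereal t < ereal e"
    unfolding eventually_at_right_field by auto
  define s where "s = b / 4"
  have "0 < s" using b(1) by (simp add: s_def)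
  have less: "smoothness_modulus f R (2 * s) / ereal (2 * s) < ereal e"
    using b by (auto simp: s_def)
  have "D (x + s *\<^sub>R y) x \<le> e * s" if "norm x \<le> r" "norm y = 1" for x y
  proof -
    define Q where "Q = ((1/2) * f (x + ((1 - 1/2) * (2 * s)) *\<^sub>R y)
      + (1 - 1/2) * f (x - ((1/2) * (2 * s)) *\<^sub>R y) - f x) / ((1/2) * (1 - 1/2))"
    have "ereal Q \<le> smoothness_modulus f R (2 * s)"
      unfolding smoothness_modulus_def Q_def using that
      by (intro Sup_upper CollectI exI[of _ x] exI[of _ y] exI[of _ "1/2"]) (auto simp: R_def)
    then have "ereal Q / ereal (2 * s) \<le> smoothness_modulus f R (2 * s) / ereal (2 * s)"
      using \<open>0 < s\<close> by (intro ereal_divide_right_mono) auto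
    from le_less_trans[OF this less] have "Q / (2 * s) < e"
      using \<open>0 < s\<close> by simp
    then have "Q < 2 * (e * s)"
      using \<open>0 < s\<close> by (simp add: pos_divide_less_eq mult.commute mult.left_commute)
    moreover have "Q = 2 * (f (x + s *\<^sub>R y) + f (x - s *\<^sub>R y) - 2 * f x)"
      by (simp add: Q_def)
    moreover have "f x - s * blinfun_apply (G x) y \<le> f (x - s *\<^sub>R y)"
      using gradient_inequality[of x "x - s *\<^sub>R y"]
      by (simp add: blinfun.minus_right blinfun.scaleR_right)
    ultimately show ?thesis
      by (simp add: bregman_dist_def blinfun.scaleR_right)
  qed
  with \<open>0 < s\<close> show ?thesis using that by blast
qed

text \<open>In terms of the conjugate, for which \<open>D z u\<close> is the height at \<open>G u\<close> above the tangent at \<open>G z\<close>,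
  this is uniform convexity. The tangent at \<open>u\<close> lies below \<open>f\<close> at every point \<open>z + s y\<close>, while \<open>f\<close>
  there exceeds the tangent at \<open>z\<close> by at most \<open>e s\<close>; hence the two slopes cannot differ much
  in any direction \<open>y\<close>.\<close>

lemma gradient_difference_bound:
  assumes "0 < e"
  obtains s where "0 < s" "\<And>z u. norm z \<le> r \<Longrightarrow> norm (G u - G z) \<le> D z u / s + e"
proof -
  obtain s where s: "0 < s" "\<And>x y. \<lbrakk>norm x \<le> r; norm y = 1\<rbrakk> \<Longrightarrow> D (x + s *\<^sub>R y) x \<le> e * s"
    using bregman_dist_upper_bound[OF assms, of r] by metis
  have "norm (G u - G z) \<le> D z u / s + e" if "norm z \<le> r" for z u
  proof (rule norm_blinfun_le_unit)
    show "0 \<le> D z u / s + e" using s(1) assms bregman_dist_nonneg[of z u] by simp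
    fix y :: 'a assume "norm y = 1"
    have "0 \<le> D (z + s *\<^sub>R y) z + D z u + blinfun_apply (G z - G u) (s *\<^sub>R y)"
      using bregman_dist_nonneg[of "z + s *\<^sub>R y" u] three_point[of "z + s *\<^sub>R y" u z] by simp
    also have "blinfun_apply (G z - G u) (s *\<^sub>R y) = - (s * blinfun_apply (G u - G z) y)"
      by (simp add: blinfun.diff_left blinfun.scaleR_right right_diff_distrib)
    finally have "s * blinfun_apply (G u - G z) y \<le> D z u + e * s"
      using s(2)[OF that \<open>norm y = 1\<close>] by linarith
    then have "blinfun_apply (G u - G z) y \<le> (D z u + e * s) / s"
      using s(1) by (simp add: pos_le_divide_eq mult.commute)
    then show "blinfun_apply (G u - G z) y \<le> D z u / s + e"
      using s(1) by (simp add: add_divide_distrib)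
  qed
  with s(1) show ?thesis using that by blast
qed

lemma gradient_bounded:
  obtains B where "0 \<le> B" "\<And>x. norm x \<le> r \<Longrightarrow> norm (G x) \<le> B"
proof -
  have "0 < \<bar>r\<bar> + 1" by simp
  then have "bounded (f ` cball 0 (\<bar>r\<bar> + 1))"
    using bounded_on_bounded unfolding bounded_on_bounded_sets_def by blast
  then obtain M where "\<forall>x\<in>cball 0 (\<bar>r\<bar> + 1). \<bar>f x\<bar> \<le> M"
    unfolding bounded_iff by auto
  then have M: "\<bar>f x\<bar> \<le> M" if "norm x \<le> \<bar>r\<bar> + 1" for x
    using that by simp
  have "0 \<le> M" using M[of 0] by simp
  have "norm (G x) \<le> 2 * M" if "norm x \<le> r" for x
  proof (rule norm_blinfun_le_unit)
    fix y :: 'a assume "norm y = 1"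
    have "blinfun_apply (G x) y \<le> f (x + y) - f x"
      using gradient_inequality[of x "x + y"] by simp
    also have "\<dots> \<le> 2 * M"
    proof -
      have "norm x \<le> \<bar>r\<bar> + 1" "norm (x + y) \<le> \<bar>r\<bar> + 1"
        using that norm_triangle_ineq[of x y] \<open>norm y = 1\<close> by linarith+
      from this[THEN M] show ?thesis by linarith
    qed
    finally show "blinfun_apply (G x) y \<le> 2 * M" .
  qed (use \<open>0 \<le> M\<close> in simp)
  with \<open>0 \<le> M\<close> show ?thesis using that[of "2 * M"] by simp
qed

lemma gradient_continuous:
  assumes "0 < e"
  obtains d where "0 < d" "\<And>v. norm (v - u) < d \<Longrightarrow> norm (G v - G u) < e"
proof -
  obtain B where B: "0 \<le> B" "\<And>x. norm x \<le> norm u + 1 \<Longrightarrow> norm (G x) \<le> B"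
    using gradient_bounded[of "norm u + 1"] by metis
  have "0 < e / 2" using assms by simp
  from gradient_difference_bound[OF this, of "norm u"] obtain s where s: "0 < s"
    "\<And>v. norm (G v - G u) \<le> D u v / s + e / 2" by (metis order_refl)
  define d where "d = min 1 (s * (e / 2) / (2 * B + 1))"
  have "0 < d" using assms B(1) s(1) by (simp add: d_def)
  have "norm (G v - G u) < e" if v: "norm (v - u) < d" for v
  proof -
    have "norm v \<le> norm u + 1"
      using v norm_triangle_ineq2[of v u] by (simp add: d_def)
    have "D u v \<le> blinfun_apply (G u - G v) (u - v)"
      using bregman_dist_sym_sum[of u v] bregman_dist_nonneg[of v u] by simp
    also have "\<dots> \<le> norm (G u - G v) * norm (u - v)"
      using norm_blinfun[of "G u - G v" "u - v"] by simp
    also have "\<dots> \<le> (2 * B + 1) * norm (u - v)"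
      using norm_triangle_ineq4[of "G u" "G v"] B(2)[of u] B(2)[OF \<open>norm v \<le> norm u + 1\<close>]
      by (intro mult_right_mono) auto
    also have "\<dots> < s * (e / 2)"
    proof -
      have "norm (u - v) < s * (e / 2) / (2 * B + 1)"
        using v by (simp add: d_def norm_minus_commute)
      moreover have "0 < 2 * B + 1" using B(1) by simp
      ultimately show ?thesis by (metis mult.commute pos_less_divide_eq)
    qed
    finally have "D u v / s < e / 2"
      using s(1) by (simp add: pos_divide_less_eq mult.commute)
    with s(2)[of v] show ?thesis by linarith
  qed
  with \<open>0 < d\<close> show ?thesis using that by blast
qed

text \<open>The factor \<open>l (1 - l)\<close> is what remains after keeping one of the two gains in the averaging identity:
  the gradient at \<open>z\<close> is at least \<open>e / 2\<close> away from that of the point with weight at most one half.\<close>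

lemma gradient_average_gap:
  assumes "0 < e"
  obtains k where "0 < k"
    "\<And>p z l u v. \<lbrakk>norm z \<le> r; 0 \<le> l; l \<le> 1; G z = l *\<^sub>R G u + (1 - l) *\<^sub>R G v; e \<le> norm (G u - G v)\<rbrakk>
      \<Longrightarrow> D p z + k * (l * (1 - l)) \<le> l * D p u + (1 - l) * D p v"
proof -
  have "0 < e / 4" using assms by simp
  from gradient_difference_bound[OF this, of r] obtain s where s: "0 < s"
    "\<And>z u. norm z \<le> r \<Longrightarrow> norm (G u - G z) \<le> D z u / s + e / 4" by metis
  define k where "k = s * (e / 4)"
  have "0 < k" using s(1) assms by (simp add: k_def)
  have far: "k \<le> D z u" if "norm z \<le> r" "e / 2 \<le> norm (G u - G z)" for z u
  proof -
    have "e / 4 \<le> D z u / s" using s(2)[OF that(1), of u] that(2) by linarith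
    then show ?thesis using s(1) by (simp add: k_def pos_le_divide_eq mult.commute)
  qed
  have "D p z + k * (l * (1 - l)) \<le> l * D p u + (1 - l) * D p v"
    if z: "norm z \<le> r" and l: "0 \<le> l" "l \<le> 1"
      and avg: "G z = l *\<^sub>R G u + (1 - l) *\<^sub>R G v" and e: "e \<le> norm (G u - G v)" for p z l u v
  proof -
    have "k * (l * (1 - l)) \<le> l * D z u + (1 - l) * D z v"
    proof (cases "l \<le> 1/2")
      case True
      have "G u - G z = (1 - l) *\<^sub>R (G u - G v)"
        unfolding avg by (simp add: scaleR_left_diff_distrib scaleR_right_diff_distrib)
      then have "norm (G u - G z) = (1 - l) * norm (G u - G v)" using l by simp
      moreover have "(1/2) * e \<le> (1 - l) * norm (G u - G v)"
        using True e assms by (intro mult_mono) auto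
      ultimately have "k \<le> D z u" by (intro far[OF z]) simp
      then have "l * (k * (1 - l)) \<le> l * D z u"
        using l \<open>0 < k\<close> by (intro mult_left_mono order_trans[OF mult_left_le]) auto
      moreover have "0 \<le> (1 - l) * D z v" using l bregman_dist_nonneg by simp
      ultimately show ?thesis by (simp add: mult.left_commute)
    next
      case False
      have "G v - G z = l *\<^sub>R (G v - G u)"
        unfolding avg by (simp add: scaleR_left_diff_distrib scaleR_right_diff_distrib)
      then have "norm (G v - G z) = l * norm (G u - G v)" using l by (simp add: norm_minus_commute)
      moreover have "(1/2) * e \<le> l * norm (G u - G v)"
        using False e assms by (intro mult_mono) auto
      ultimately have "k \<le> D z v" by (intro far[OF z]) simp
      then have "(1 - l) * (k * l) \<le> (1 - l) * D z v"
        using l \<open>0 < k\<close> by (intro mult_left_mono order_trans[OF mult_left_le]) auto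
      moreover have "0 \<le> l * D z u" using l bregman_dist_nonneg by simp
      ultimately show ?thesis by (simp add: mult.commute mult.left_commute)
    qed
    then show ?thesis using gradient_average[OF avg, of p] by linarith
  qed
  with \<open>0 < k\<close> show ?thesis using that by blast
qed

end

section \<open>Weak sequential compactness\<close>

primrec rational_combinations :: "(nat \<Rightarrow> 'a::real_vector) \<Rightarrow> nat \<Rightarrow> 'a set" where
  "rational_combinations X 0 = {0}"
| "rational_combinations X (Suc n) = (\<lambda>(v, q). v + q *\<^sub>R X n) ` (rational_combinations X n \<times> \<rat>)"

lemma rational_combinations_mono:
  "m \<le> n \<Longrightarrow> rational_combinations X m \<subseteq> rational_combinations X n"
proof (induction rule: dec_induct)
  case (step n)
  have "v \<in> rational_combinations X (Suc n)" if "v \<in> rational_combinations X n" for v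
    using that by (force intro!: image_eqI[of _ _ "(v, 0)"])
  with step show ?case by blast
qed simp

lemma countable_rational_combinations: "countable (rational_combinations X n)"
  by (induction n) (auto intro!: countable_image countable_SIGMA countable_rat)

lemma rational_combinations_add:
  "\<lbrakk>v \<in> rational_combinations X n; w \<in> rational_combinations X n\<rbrakk> \<Longrightarrow> v + w \<in> rational_combinations X n"
proof (induction n arbitrary: v w)
  case (Suc n)
  then obtain v' q w' q' where *: "v = v' + q *\<^sub>R X n" "w = w' + q' *\<^sub>R X n"
    "v' \<in> rational_combinations X n" "w' \<in> rational_combinations X n" "q \<in> \<rat>" "q' \<in> \<rat>"
    by auto
  have "v + w = (v' + w') + (q + q') *\<^sub>R X n" by (simp add: * scaleR_add_left)
  then show ?case using Suc.IH[OF *(3,4)] *(5,6) by (force intro!: image_eqI[of _ _ "(v' + w', q + q')"])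
qed simp

lemma rational_combinations_scale:
  "\<lbrakk>v \<in> rational_combinations X n; r \<in> \<rat>\<rbrakk> \<Longrightarrow> r *\<^sub>R v \<in> rational_combinations X n"
proof (induction n arbitrary: v)
  case (Suc n)
  then obtain v' q where *: "v = v' + q *\<^sub>R X n" "v' \<in> rational_combinations X n" "q \<in> \<rat>"
    by auto
  have "r *\<^sub>R v = r *\<^sub>R v' + (r * q) *\<^sub>R X n" by (simp add: * scaleR_add_right)
  then show ?case using Suc.IH[OF *(2)] *(3) Suc.prems(2)
    by (force intro!: image_eqI[of _ _ "(r *\<^sub>R v', r * q)"])
qed simp

text \<open>A countable set closed under addition and rational scaling has a linear closure.\<close>

lemma separable_closed_subspace_containing_sequence:
  fixes X :: "nat \<Rightarrow> 'a::real_normed_vector"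
  obtains S where "countable S" "S \<noteq> {}" "range X \<subseteq> S" "subspace (closure S)"
proof
  define S where "S = (\<Union>n. rational_combinations X n)"
  show "countable S" by (simp add: S_def countable_rational_combinations)
  have "0 \<in> S" unfolding S_def by (rule UN_I[of 0]) simp_all
  then show "S \<noteq> {}" by blast
  have "X n \<in> rational_combinations X (Suc n)" for n
  proof -
    have "0 \<in> rational_combinations X n" using rational_combinations_mono[of 0 n X] by simp
    then show ?thesis by (force intro!: image_eqI[of _ _ "(0, 1)"])
  qed
  then show "range X \<subseteq> S" unfolding S_def by blast
  have add: "v + w \<in> S" if "v \<in> S" "w \<in> S" for v w
  proof -
    obtain m n where "v \<in> rational_combinations X m" "w \<in> rational_combinations X n"
      using \<open>v \<in> S\<close> \<open>w \<in> S\<close> unfolding S_def by blast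
    then have "v + w \<in> rational_combinations X (max m n)"
      using rational_combinations_mono[of m "max m n" X] rational_combinations_mono[of n "max m n" X]
      by (intro rational_combinations_add) auto
    then show ?thesis unfolding S_def by blast
  qed
  have scale: "q *\<^sub>R v \<in> S" if "v \<in> S" "q \<in> \<rat>" for q v
    using that rational_combinations_scale unfolding S_def by blast
  show "subspace (closure S)"
  proof (rule subspaceI)
    show "0 \<in> closure S" using \<open>0 \<in> S\<close> closure_subset by blast
    show "v + w \<in> closure S" if vw: "v \<in> closure S" "w \<in> closure S" for v w
    proof -
      obtain V W where VW: "\<And>n. V n \<in> S" "V \<longlonglongrightarrow> v" "\<And>n. W n \<in> S" "W \<longlonglongrightarrow> w"
        using vw unfolding closure_sequential by metis
      then have "(\<lambda>n. V n + W n) \<longlonglongrightarrow> v + w" by (intro tendsto_add)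
      moreover have "\<And>n. V n + W n \<in> S" using VW(1,3) add by blast
      ultimately show ?thesis unfolding closure_sequential by (metis (no_types, lifting))
    qed
    show "c *\<^sub>R v \<in> closure S" if v: "v \<in> closure S" for c v
    proof -
      obtain V where V: "\<And>n. V n \<in> S" "V \<longlonglongrightarrow> v"
        using v unfolding closure_sequential by metis
      have "c \<in> closure \<rat>"
        by (simp add: Rats_closure_real)
      then obtain q where q: "\<And>n. q n \<in> \<rat>" "q \<longlonglongrightarrow> c"
        unfolding closure_sequential by metis
      have "(\<lambda>n. q n *\<^sub>R V n) \<longlonglongrightarrow> c *\<^sub>R v" using V q by (intro tendsto_scaleR)
      moreover have "\<And>n. q n *\<^sub>R V n \<in> S" using V(1) q(1) scale by blast
      ultimately show ?thesis unfolding closure_sequential by (metis (no_types, lifting))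
    qed
  qed
qed

text \<open>The pointwise limit is a bounded functional on the dual, hence an evaluation.\<close>

lemma reflexive_weak_limit:
  fixes X :: "nat \<Rightarrow> 'a::real_normed_vector"
  assumes refl: "reflexive_space TYPE('a)" and bound: "\<And>n. norm (X n) \<le> r"
    and conv: "\<And>g :: 'a \<Rightarrow>\<^sub>L real. convergent (\<lambda>n. blinfun_apply g (X n))"
  obtains p where "weakly_converges X p"
proof -
  define L where "L g = lim (\<lambda>n. blinfun_apply g (X n))" for g :: "'a \<Rightarrow>\<^sub>L real"
  have L: "(\<lambda>n. blinfun_apply g (X n)) \<longlonglongrightarrow> L g" for g :: "'a \<Rightarrow>\<^sub>L real"
    using conv[of g] by (simp add: L_def convergent_LIMSEQ_iff)
  have "bounded_linear L"
  proof (rule bounded_linear_intro)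
    show "L (g + h) = L g + L h" for g h
      using tendsto_add[OF L[of g] L[of h]] L[of "g + h"]
      by (intro LIMSEQ_unique) (simp_all add: blinfun.add_left)
    show "L (c *\<^sub>R g) = c *\<^sub>R L g" for c g
      using tendsto_mult_left[OF L[of g], of c] L[of "c *\<^sub>R g"]
      by (intro LIMSEQ_unique) (simp_all add: blinfun.scaleR_left)
    show "norm (L g) \<le> norm g * r" for g
    proof (rule LIMSEQ_le_const2[OF tendsto_norm[OF L[of g]]], intro exI allI impI)
      show "norm (blinfun_apply g (X n)) \<le> norm g * r" for n
        using norm_blinfun[of g "X n"] mult_left_mono[OF bound[of n] norm_ge_zero[of g]] by linarith
    qed
  qed
  then have "blinfun_apply (Blinfun L) = L" by (rule bounded_linear_Blinfun_apply)
  then obtain p where "\<And>g. L g = blinfun_apply g p"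
    using refl unfolding reflexive_space_def by metis
  then have "weakly_converges X p" unfolding weakly_converges_def using L by metis
  then show ?thesis by (rule that)
qed

locale bregman_kernel = coercive_uniformly_convex f + uniformly_smooth_convex f
  for f :: "'a::banach \<Rightarrow> real"
begin

text \<open>Take a separable closed subspace \<open>M\<close> containing the sequence. Each functional agrees on \<open>M\<close> with
  \<open>G u\<close> for some \<open>u\<close> in \<open>M\<close>, and \<open>G\<close> is norm continuous, so the gradients at a countable dense
  subset of \<open>M\<close> approximate all functionals on \<open>M\<close> in norm. A diagonal subsequence on which these
  countably many converge therefore converges under every functional.\<close>

lemma bounded_weakly_convergent_subsequence:
  fixes X :: "nat \<Rightarrow> 'a"
  assumes refl: "reflexive_space TYPE('a)" and bound: "\<And>n. norm (X n) \<le> r"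
  obtains \<sigma> p where "strict_mono \<sigma>" "weakly_converges (X \<circ> \<sigma>) p"
proof -
  obtain S where S: "countable S" "S \<noteq> {}" "range X \<subseteq> S" "subspace (closure S)"
    using separable_closed_subspace_containing_sequence[of X] by metis
  define d where "d = from_nat_into S"
  define P where "P n s \<longleftrightarrow> convergent (\<lambda>k. blinfun_apply (G (d n)) (X (s k)))" for n s
  have ex: "\<exists>s'. strict_mono s' \<and> P n (s \<circ> s')" for n and s :: "nat \<Rightarrow> nat"
  proof -
    have "norm (blinfun_apply (G (d n)) (X (s k))) \<le> norm (G (d n)) * r" for k
      using norm_blinfun[of "G (d n)" "X (s k)"] mult_left_mono[OF bound[of "s k"] norm_ge_zero[of "G (d n)"]]
      by linarith
    then have "bounded (range (\<lambda>k. blinfun_apply (G (d n)) (X (s k))))"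
      unfolding bounded_iff by blast
    from bounded_imp_convergent_subsequence[OF this] show ?thesis
      unfolding P_def convergent_def o_def by blast
  qed
  interpret subseqs P by unfold_locales (rule ex)
  define \<sigma> where "\<sigma> = diagseq"
  have "strict_mono \<sigma>" unfolding \<sigma>_def by (rule subseq_diagseq)
  have "P n (diagseq \<circ> ((+) (Suc n)))" for n
  proof (rule diagseq_holds)
    fix s' s :: "nat \<Rightarrow> nat" and n assume "strict_mono s'" "P n s"
    then show "P n (s \<circ> s')"
      unfolding P_def using convergent_subseq_convergent[of "\<lambda>k. blinfun_apply (G (d n)) (X (s k))" s']
      by (simp add: o_def)
  qed
  then have shifted: "convergent (\<lambda>k. blinfun_apply (G (d n)) (X (\<sigma> (Suc n + k))))" for n
    by (simp add: P_def \<sigma>_def o_def)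
  have conv_d: "convergent (\<lambda>k. blinfun_apply (G (d n)) (X (\<sigma> k)))" for n
    using shifted[of n]
      convergent_ignore_initial_segment[of "\<lambda>k. blinfun_apply (G (d n)) (X (\<sigma> k))" "Suc n"]
    unfolding add.commute[of "Suc n"] by blast
  have "0 \<le> r" using bound[of 0] norm_ge_zero order_trans by blast
  have "convergent (\<lambda>k. blinfun_apply g (X (\<sigma> k)))" for g :: "'a \<Rightarrow>\<^sub>L real"
    unfolding Cauchy_convergent_iff[symmetric]
  proof (rule metric_CauchyI)
    fix e :: real assume "0 < e"
    obtain u where u: "u \<in> closure S" "\<And>y. y \<in> closure S \<Longrightarrow> blinfun_apply (G u) y = blinfun_apply g y"
      using gradient_on_subspace[OF closed_closure S(4), of g] by metis
    define h where "h = e / (4 * (r + 1))"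
    have "0 < h" using \<open>0 < e\<close> \<open>0 \<le> r\<close> by (simp add: h_def)
    from gradient_continuous[OF this, of u] obtain \<delta> where \<delta>: "0 < \<delta>"
      "\<And>v. norm (v - u) < \<delta> \<Longrightarrow> norm (G v - G u) < h" by metis
    obtain v where "v \<in> S" "norm (v - u) < \<delta>"
      using u(1) \<delta>(1) unfolding closure_approachable dist_norm by blast
    then obtain n where n: "norm (G (d n) - G u) < h"
      using \<delta>(2) from_nat_into_surj[OF S(1)] unfolding d_def by metis
    have near: "\<bar>blinfun_apply (G (d n)) (X k) - blinfun_apply g (X k)\<bar> \<le> e / 4" for k
    proof -
      have "X k \<in> closure S" using S(3) closure_subset by blast
      then have "\<bar>blinfun_apply (G (d n)) (X k) - blinfun_apply g (X k)\<bar>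
          = \<bar>blinfun_apply (G (d n) - G u) (X k)\<bar>"
        using u(2) by (simp add: blinfun.diff_left)
      also have "\<dots> \<le> norm (G (d n) - G u) * norm (X k)"
        using norm_blinfun[of "G (d n) - G u" "X k"] by simp
      also have "\<dots> \<le> h * (r + 1)"
        using n bound[of k] \<open>0 < h\<close> by (intro mult_mono) auto
      also have "\<dots> = e / 4" using \<open>0 \<le> r\<close> by (simp add: h_def field_simps)
      finally show ?thesis .
    qed
    have "Cauchy (\<lambda>k. blinfun_apply (G (d n)) (X (\<sigma> k)))"
      using conv_d[of n] by (rule convergent_Cauchy)
    then obtain N where N: "\<And>i j. \<lbrakk>N \<le> i; N \<le> j\<rbrakk> \<Longrightarrow>
        dist (blinfun_apply (G (d n)) (X (\<sigma> i))) (blinfun_apply (G (d n)) (X (\<sigma> j))) < e / 2"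
      using metric_CauchyD[of _ "e/2"] \<open>0 < e\<close> by (metis half_gt_zero)
    have "dist (blinfun_apply g (X (\<sigma> i))) (blinfun_apply g (X (\<sigma> j))) < e" if "N \<le> i" "N \<le> j" for i j
      using N[OF that] near[of "\<sigma> i"] near[of "\<sigma> j"] unfolding dist_real_def by linarith
    then show "\<exists>N. \<forall>i\<ge>N. \<forall>j\<ge>N. dist (blinfun_apply g (X (\<sigma> i))) (blinfun_apply g (X (\<sigma> j))) < e"
      by blast
  qed
  then obtain p where "weakly_converges (\<lambda>k. X (\<sigma> k)) p"
    using reflexive_weak_limit[OF refl, of "\<lambda>k. X (\<sigma> k)" r] bound by blast
  with \<open>strict_mono \<sigma>\<close> show ?thesis using that[of \<sigma> p] by (simp add: o_def)
qed

section \<open>Fixed points of Bregman generalized nonexpansive maps\<close>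

lemma nonexpansive_fixed_point_le:
  assumes T: "bregman_generalized_nonexpansive f C a T" and p: "p \<in> C" "T p = p" and x: "x \<in> C"
  shows "D p (T x) \<le> D p x"
proof -
  have a: "0 \<le> a" "a < 1" using T by (auto simp: bregman_generalized_nonexpansive_def)
  have "D (T p) (T x) \<le> a * D (T p) x + a * D p (T x) + (1 - 2 * a) * D p x"
    using T p(1) x unfolding bregman_generalized_nonexpansive_def by blast
  then have "(1 - a) * D p (T x) \<le> (1 - a) * D p x" by (simp add: p(2) algebra_simps)
  then show ?thesis using a by simp
qed

text \<open>Since \<open>f\<close> is Lipschitz on balls, \<open>D (T (X n)) w\<close> and \<open>D (X n) w\<close> differ by a null sequence, so the
  inequality for \<open>T\<close> at \<open>X n\<close> and \<open>p\<close> says that \<open>(1 - a) (D (X n) (T p) - D (X n) p)\<close> is at most a null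
  sequence. Its limit is \<open>(1 - a) D p (T p)\<close>.\<close>

lemma demiclosed:
  fixes X :: "nat \<Rightarrow> 'a"
  assumes T: "bregman_generalized_nonexpansive f C a T"
    and C: "\<And>n. X n \<in> C" "p \<in> C"
    and bound: "\<And>n. norm (X n) \<le> r" "\<And>n. norm (T (X n)) \<le> r"
    and approx: "(\<lambda>n. T (X n) - X n) \<longlonglongrightarrow> 0"
    and weak: "weakly_converges X p"
  shows "T p = p"
proof -
  have a: "0 \<le> a" "a < 1" using T by (auto simp: bregman_generalized_nonexpansive_def)
  obtain B where B: "\<And>x. norm x \<le> r \<Longrightarrow> norm (G x) \<le> B"
    using gradient_bounded[of r] by metis
  \<comment> \<open>The tangents at both points bound the increment by a multiple of the displacement.\<close>
  have f0: "(\<lambda>n. f (T (X n)) - f (X n)) \<longlonglongrightarrow> 0"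
  proof (rule Lim_null_comparison)
    show "(\<lambda>n. B * norm (T (X n) - X n)) \<longlonglongrightarrow> 0"
      by (rule tendsto_mult_right_zero) (rule tendsto_norm_zero[OF approx])
    have Bx: "\<bar>blinfun_apply (G v) (T (X n) - X n)\<bar> \<le> B * norm (T (X n) - X n)" if "norm v \<le> r" for v n
      using norm_blinfun[of "G v" "T (X n) - X n"] mult_right_mono[OF B[OF that] norm_ge_zero[of "T (X n) - X n"]]
      by simp
    have "norm (f (T (X n)) - f (X n)) \<le> B * norm (T (X n) - X n)" for n
      using gradient_inequality[of "X n" "T (X n)"] gradient_inequality[of "T (X n)" "X n"]
        Bx[OF bound(1)[of n], of n] Bx[OF bound(2)[of n], of n]
      by (simp add: blinfun.diff_right abs_le_iff)
    then show "eventually (\<lambda>n. norm (f (T (X n)) - f (X n)) \<le> B * norm (T (X n) - X n)) sequentially"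
      by (simp add: always_eventually)
  qed
  define E where "E w n = D (T (X n)) w - D (X n) w" for w n
  have E: "E w \<longlonglongrightarrow> 0" for w
  proof -
    have "(\<lambda>n. f (T (X n)) - f (X n) - blinfun_apply (G w) (T (X n) - X n)) \<longlonglongrightarrow> 0 - blinfun_apply (G w) 0"
      by (intro tendsto_diff f0 blinfun.tendsto tendsto_const approx)
    moreover have "E w = (\<lambda>n. f (T (X n)) - f (X n) - blinfun_apply (G w) (T (X n) - X n))"
      by (rule ext) (simp add: E_def bregman_dist_def blinfun.diff_right)
    ultimately show ?thesis by (simp add: blinfun.zero_right)
  qed
  \<comment> \<open>The three point identity turns the weak limit into a limit of differences of distances.\<close>
  have "(\<lambda>n. blinfun_apply (G p - G (T p)) (X n)) \<longlonglongrightarrow> blinfun_apply (G p - G (T p)) p"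
    using weak unfolding weakly_converges_def by blast
  then have "(\<lambda>n. D p (T p) + (blinfun_apply (G p - G (T p)) (X n) - blinfun_apply (G p - G (T p)) p))
      \<longlonglongrightarrow> D p (T p) + (blinfun_apply (G p - G (T p)) p - blinfun_apply (G p - G (T p)) p)"
    by (intro tendsto_add tendsto_diff tendsto_const)
  moreover have "D p (T p) + (blinfun_apply (G p - G (T p)) (X n) - blinfun_apply (G p - G (T p)) p)
      = D (X n) (T p) - D (X n) p" for n
    using three_point[of "X n" "T p" p] by (simp add: blinfun.diff_right)
  ultimately have "(\<lambda>n. D (X n) (T p) - D (X n) p) \<longlonglongrightarrow> D p (T p)" by simp
  then have lhs: "(\<lambda>n. (1 - a) * (D (X n) (T p) - D (X n) p)) \<longlonglongrightarrow> (1 - a) * D p (T p)"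
    by (rule tendsto_mult_left)
  have rhs: "(\<lambda>n. a * E p n - E (T p) n) \<longlonglongrightarrow> a * 0 - 0"
    by (intro tendsto_diff tendsto_mult_left E)
  have "(1 - a) * (D (X n) (T p) - D (X n) p) \<le> a * E p n - E (T p) n" for n
  proof -
    have "D (T (X n)) (T p) \<le> a * D (T (X n)) p + a * D (X n) (T p) + (1 - 2 * a) * D (X n) p"
      using T C unfolding bregman_generalized_nonexpansive_def by blast
    then show ?thesis by (simp add: E_def algebra_simps)
  qed
  then have "(1 - a) * D p (T p) \<le> a * 0 - 0"
    by (intro LIMSEQ_le[OF lhs rhs]) blast
  then have "D p (T p) \<le> 0" using a by (simp add: mult_le_0_iff)
  then show ?thesis by (simp add: bregman_dist_le_0_iff)
qed

end

lemma divergent_sum_descent: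
  fixes A c :: "nat \<Rightarrow> real"
  assumes A: "\<And>n. 0 \<le> A n" and k: "0 < k"
    and descent: "\<And>n. N \<le> n \<Longrightarrow> A (Suc n) + k * c n \<le> A n"
  shows "\<not> filterlim (\<lambda>n. \<Sum>i=1..n. c i) at_top sequentially"
proof
  assume "filterlim (\<lambda>n. \<Sum>i=1..n. c i) at_top sequentially"
  define b where "b = (A (Suc N) + k * (\<Sum>i=1..N. c i)) / k"
  have "A (Suc n) + k * (\<Sum>i=1..n. c i) \<le> A (Suc N) + k * (\<Sum>i=1..N. c i)" if "N \<le> n" for n
    using that
  proof (induction rule: dec_induct)
    case (step n)
    then show ?case using descent[of "Suc n"] by (simp add: distrib_left)
  qed simp
  then have "(\<Sum>i=1..n. c i) \<le> b" if "N \<le> n" for n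
    using A[of "Suc n"] k that unfolding b_def
    by (simp add: pos_le_divide_eq mult.commute) (smt (verit))
  moreover have "eventually (\<lambda>n. b < (\<Sum>i=1..n. c i)) sequentially"
    using \<open>filterlim _ _ _\<close> unfolding filterlim_at_top_dense by blast
  then obtain M where "\<And>n. M \<le> n \<Longrightarrow> b < (\<Sum>i=1..n. c i)"
    unfolding eventually_sequentially by blast
  ultimately show False by (metis leD max.cobounded1 max.cobounded2)
qed

theorem theorem5p3:
  fixes f :: "'a::banach \<Rightarrow> real"
    and C :: "'a set"
    and T :: "'a \<Rightarrow> 'a"
    and a :: real
    and \<alpha> \<beta> \<gamma> :: "nat \<Rightarrow> real"
    and x y z :: "nat \<Rightarrow> 'a"
  assumes "reflexive_space TYPE('a)"
    and "bregman_function f"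
    and "strongly_coercive f"
    and "bounded_on_bounded_sets f"
    and "locally_uniformly_convex f"
    and "locally_uniformly_smooth f"
    and "C \<noteq> {}" and "closed C" and "convex C"
    and "T \<in> C \<rightarrow> C"
    and "bregman_generalized_nonexpansive f C a T"
    and "fixed_points C T \<noteq> {}"
    and "\<And>n. n \<ge> 1 \<Longrightarrow> \<alpha> n \<in> {0..<1}"
    and "\<And>n. n \<ge> 1 \<Longrightarrow> \<beta> n \<in> {0..<1}"
    and "\<And>n. n \<ge> 1 \<Longrightarrow> \<gamma> n \<in> {0..<1}"
    and "filterlim (\<lambda>N. \<Sum>n=1..N. \<gamma> n * \<beta> n * \<alpha> n * (1 - \<alpha> n)) at_top sequentially"
    and "\<And>n. n \<ge> 1 \<Longrightarrow> x n \<in> C"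
    and "\<And>n. n \<ge> 1 \<Longrightarrow> y n \<in> C"
    and "\<And>n. n \<ge> 1 \<Longrightarrow> z n \<in> C"
    and "\<And>n. n \<ge> 1 \<Longrightarrow>
           z n = grad_conjugate f (\<alpha> n *\<^sub>R grad f (T (x n)) + (1 - \<alpha> n) *\<^sub>R grad f (x n))"
    and "\<And>n. n \<ge> 1 \<Longrightarrow>
           y n = grad_conjugate f (\<beta> n *\<^sub>R grad f (T (z n)) + (1 - \<beta> n) *\<^sub>R grad f (x n))"
    and "\<And>n. n \<ge> 1 \<Longrightarrow>
           x (Suc n) = bregman_proj f C
             (grad_conjugate f (\<gamma> n *\<^sub>R grad f (T (y n)) + (1 - \<gamma> n) *\<^sub>R grad f (x n)))"
  shows "\<exists>\<nu> :: nat \<Rightarrow> nat. strict_mono \<nu> \<and> (\<forall>i. \<nu> i \<ge> 1) \<and>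
           (\<exists>p \<in> fixed_points C T. weakly_converges (\<lambda>i. x (\<nu> i)) p)"
proof -
  note refl = assms(1) and bregman = assms(2) and T = assms(11)
    and \<alpha> = assms(13) and \<beta> = assms(14) and \<gamma> = assms(15) and diverges = assms(16)
    and xC = assms(17) and yC = assms(18) and zC = assms(19)
    and z_def = assms(20) and y_def = assms(21) and x_Suc = assms(22)
  interpret bregman_kernel f
  proof
    show "convex_on UNIV f"
    proof (rule convex_onI)
      fix t :: real and u v :: 'a assume "0 < t" "t < 1"
      then show "f ((1 - t) *\<^sub>R u + t *\<^sub>R v) \<le> (1 - t) * f u + t * f v"
      proof (cases "u = v")
        case True
        then show ?thesis by (simp flip: scaleR_add_left distrib_right)
      next
        case False
        moreover have "1 - t \<in> {0<..<1}" using \<open>0 < t\<close> \<open>t < 1\<close> by simp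
        ultimately have "f ((1 - t) *\<^sub>R u + (1 - (1 - t)) *\<^sub>R v) < (1 - t) * f u + (1 - (1 - t)) * f v"
          using bregman unfolding bregman_function_def strictly_convex_def by blast
        then show ?thesis by simp
      qed
    qed simp
  qed (use assms(2-6) in \<open>auto simp: bregman_function_def\<close>)
  have level: "bounded {v. D u v \<le> b}" if "0 < b" for u b
    using bregman that unfolding bregman_function_def by blast
  obtain q where q: "q \<in> C" "T q = q" using assms(12) by (auto simp: fixed_points_def)
  have Tq: "D q (T u) \<le> D q u" if "u \<in> C" for u
    using nonexpansive_fixed_point_le[OF T q that] .

  have average: "D q w \<le> (1 - l) * D q v + l * D q u"
    if "w = grad_conjugate f (l *\<^sub>R G (T u) + (1 - l) *\<^sub>R G v)" "l \<in> {0..<1}" "u \<in> C" for w l u v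
  proof -
    have "D q w \<le> l * D q (T u) + (1 - l) * D q v"
      using that by (intro gradient_average_le) (auto simp: gradient_grad_conjugate)
    moreover have "l * D q (T u) \<le> l * D q u"
      using that Tq by (intro mult_left_mono) auto
    ultimately show ?thesis by linarith
  qed
  have z_le: "D q (z n) \<le> D q (x n)" if "1 \<le> n" for n
    using average[OF z_def[OF that] \<alpha>[OF that] xC[OF that]] by (simp add: algebra_simps)
  \<comment> \<open>Only the gain of the first averaging is kept. The later ones pass it on with weights
    \<open>\<beta> n\<close> and \<open>\<gamma> n\<close>.\<close>
  have x_le: "D q (x (Suc n)) \<le> D q (x n) - \<gamma> n * \<beta> n * (D q (x n) - D q (z n))" if n: "1 \<le> n" for n
  proof -
    define w where "w = grad_conjugate f (\<gamma> n *\<^sub>R G (T (y n)) + (1 - \<gamma> n) *\<^sub>R G (x n))"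
    have "D q (x (Suc n)) \<le> D q w"
      using bregman_proj_properties(2)[OF assms(8,9,7) q(1), of w] bregman_dist_nonneg[of "x (Suc n)" w]
      by (simp add: x_Suc[OF n] w_def)
    also have "\<dots> \<le> (1 - \<gamma> n) * D q (x n) + \<gamma> n * D q (y n)"
      by (rule average[OF w_def \<gamma>[OF n] yC[OF n]])
    also have "\<dots> \<le> (1 - \<gamma> n) * D q (x n) + \<gamma> n * ((1 - \<beta> n) * D q (x n) + \<beta> n * D q (z n))"
      using average[OF y_def[OF n] \<beta>[OF n] zC[OF n]] \<gamma>[OF n]
      by (intro add_left_mono mult_left_mono) auto
    finally show ?thesis by (simp add: algebra_simps)
  qed
  have x_decreasing: "D q (x (Suc n)) \<le> D q (x n)" if n: "1 \<le> n" for n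
  proof -
    have "0 \<le> \<gamma> n * \<beta> n * (D q (x n) - D q (z n))"
      using \<gamma>[OF n] \<beta>[OF n] z_le[OF n] by simp
    with x_le[OF n] show ?thesis by linarith
  qed
  \<comment> \<open>The added \<open>1\<close> keeps the level positive when \<open>x 1 = q\<close>; only positive levels are known to have
    bounded level sets.\<close>
  have x_bound: "D q (x n) \<le> D q (x 1) + 1" if "1 \<le> n" for n
    using that
  proof (induction rule: dec_induct)
    case (step n)
    then show ?case using x_decreasing[of n] by linarith
  qed simp
  have "bounded {v. D q v \<le> D q (x 1) + 1}"
    using bregman_dist_nonneg[of q "x 1"] by (intro level) linarith
  then obtain r where "\<forall>v\<in>{v. D q v \<le> D q (x 1) + 1}. norm v \<le> r"
    unfolding bounded_iff by blast
  then have r: "norm v \<le> r" if "D q v \<le> D q (x 1) + 1" for v using that by blast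
  have xr: "norm (x n) \<le> r" if "1 \<le> n" for n using r x_bound that by blast
  have Txr: "norm (T (x n)) \<le> r" if "1 \<le> n" for n
    using Tq[OF xC[OF that]] x_bound[OF that] by (intro r) linarith
  have zr: "norm (z n) \<le> r" if "1 \<le> n" for n
    using z_le[OF that] x_bound[OF that] by (intro r) linarith

  \<comment> \<open>Otherwise the distance to \<open>q\<close> would decrease by a divergent total amount.\<close>
  have often: "\<exists>n\<ge>N. 1 \<le> n \<and> norm (G (T (x n)) - G (x n)) < e" if "0 < e" for e N
  proof (rule ccontr)
    assume "\<not> ?thesis"
    then have far: "e \<le> norm (G (T (x n)) - G (x n))" if "N \<le> n" "1 \<le> n" for n
      using that not_less by blast
    obtain k where k: "0 < k"
      "\<And>p z l u v. \<lbrakk>norm z \<le> r; 0 \<le> l; l \<le> 1; G z = l *\<^sub>R G u + (1 - l) *\<^sub>R G v; e \<le> norm (G u - G v)\<rbrakk>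
        \<Longrightarrow> D p z + k * (l * (1 - l)) \<le> l * D p u + (1 - l) * D p v"
      using gradient_average_gap[OF \<open>0 < e\<close>, of r] by metis
    have "D q (x (Suc n)) + k * (\<gamma> n * \<beta> n * \<alpha> n * (1 - \<alpha> n)) \<le> D q (x n)" if "max N 1 \<le> n" for n
    proof -
      have n: "1 \<le> n" "N \<le> n" using that by auto
      have "D q (z n) + k * (\<alpha> n * (1 - \<alpha> n)) \<le> \<alpha> n * D q (T (x n)) + (1 - \<alpha> n) * D q (x n)"
        using \<alpha>[OF n(1)] far[OF n(2,1)] zr[OF n(1)]
        by (intro k(2)) (auto simp: z_def[OF n(1)] gradient_grad_conjugate)
      moreover have "\<alpha> n * D q (T (x n)) \<le> \<alpha> n * D q (x n)"
        using \<alpha>[OF n(1)] Tq[OF xC[OF n(1)]] by (intro mult_left_mono) auto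
      ultimately have "k * (\<alpha> n * (1 - \<alpha> n)) \<le> D q (x n) - D q (z n)"
        by (simp add: algebra_simps)
      then have "\<gamma> n * \<beta> n * (k * (\<alpha> n * (1 - \<alpha> n))) \<le> \<gamma> n * \<beta> n * (D q (x n) - D q (z n))"
        using \<gamma>[OF n(1)] \<beta>[OF n(1)] by (intro mult_left_mono) auto
      moreover have "\<gamma> n * \<beta> n * (k * (\<alpha> n * (1 - \<alpha> n))) = k * (\<gamma> n * \<beta> n * \<alpha> n * (1 - \<alpha> n))"
        by simp
      ultimately show ?thesis using x_le[OF n(1)] by linarith
    qed
    from divergent_sum_descent[of "\<lambda>n. D q (x n)" k "max N 1"
        "\<lambda>n. \<gamma> n * \<beta> n * \<alpha> n * (1 - \<alpha> n)", OF bregman_dist_nonneg k(1) this] diverges show False by blast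
  qed
  have "\<exists>\<mu>. \<forall>i. (1 \<le> \<mu> i \<and> norm (G (T (x (\<mu> i))) - G (x (\<mu> i))) < 1 / Suc i) \<and> \<mu> i < \<mu> (Suc i)"
  proof (rule dependent_nat_choice)
    show "\<exists>n. 1 \<le> n \<and> norm (G (T (x n)) - G (x n)) < 1 / Suc 0"
      using often[of "1 / Suc 0" 1] by auto
    show "\<exists>m. (1 \<le> m \<and> norm (G (T (x m)) - G (x m)) < 1 / Suc (Suc i)) \<and> n < m" for n i
      using often[of "1 / Suc (Suc i)" "Suc n"] by (auto simp: Suc_le_eq)
  qed
  then obtain \<mu> where \<mu>: "\<And>i. 1 \<le> \<mu> i" "\<And>i. norm (G (T (x (\<mu> i))) - G (x (\<mu> i))) < 1 / Suc i"
    "\<And>i. \<mu> i < \<mu> (Suc i)" by metis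
  have "strict_mono \<mu>" using \<mu>(3) by (simp add: strict_mono_Suc_iff)
  have approx: "(\<lambda>i. T (x (\<mu> i)) - x (\<mu> i)) \<longlonglongrightarrow> 0"
  proof (rule LIMSEQ_I)
    fix e :: real assume "0 < e"
    from gradient_inverse_continuous_on_ball[OF this, of r] obtain d where d: "0 < d"
      "\<And>u v. \<lbrakk>norm u \<le> r; norm v \<le> r; norm (G u - G v) < d\<rbrakk> \<Longrightarrow> norm (u - v) < e" by metis
    obtain N where N: "1 / real (Suc N) < d" using nat_approx_posE[OF d(1)] by metis
    have "norm (T (x (\<mu> i)) - x (\<mu> i) - 0) < e" if "N \<le> i" for i
    proof -
      have "1 / real (Suc i) \<le> 1 / real (Suc N)" using that by (simp add: frac_le)
      then have "norm (G (T (x (\<mu> i))) - G (x (\<mu> i))) < d" using \<mu>(2)[of i] N by linarith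
      then show ?thesis using d(2)[OF Txr[OF \<mu>(1)] xr[OF \<mu>(1)]] by simp
    qed
    then show "\<exists>N. \<forall>i\<ge>N. norm (T (x (\<mu> i)) - x (\<mu> i) - 0) < e" by blast
  qed
  obtain \<sigma> p where \<sigma>: "strict_mono \<sigma>" "weakly_converges ((\<lambda>i. x (\<mu> i)) \<circ> \<sigma>) p"
    using bounded_weakly_convergent_subsequence[OF refl, of "\<lambda>i. x (\<mu> i)" r] xr[OF \<mu>(1)] by metis
  define \<nu> where "\<nu> = \<mu> \<circ> \<sigma>"
  have "strict_mono \<nu>" unfolding \<nu>_def using \<open>strict_mono \<mu>\<close> \<sigma>(1) by (rule strict_mono_o)
  have \<nu>1: "1 \<le> \<nu> i" for i by (simp add: \<nu>_def \<mu>(1)[simplified])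
  have weak: "weakly_converges (\<lambda>i. x (\<nu> i)) p" using \<sigma>(2) by (simp add: \<nu>_def o_def)
  have "p \<in> C" using weakly_closed[OF assms(8,9) xC[OF \<nu>1] weak] .
  moreover have "T p = p"
  proof (rule demiclosed[OF T])
    show "(\<lambda>i. T (x (\<nu> i)) - x (\<nu> i)) \<longlonglongrightarrow> 0"
      using LIMSEQ_subseq_LIMSEQ[OF approx \<sigma>(1)] by (simp add: \<nu>_def o_def)
  qed (use xC \<nu>1 xr Txr weak \<open>p \<in> C\<close> in auto)
  ultimately have "p \<in> fixed_points C T" by (simp add: fixed_points_def)
  with \<open>strict_mono \<nu>\<close> \<nu>1 weak show ?thesis by blast
qed

end
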